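(* Let $(G,\le_G)$ be an ordered group, and let $H$ be the lattice-ordered group freely generated by $G$, with universal morphism of ordered groups $\varphi\colon G\to H$. Then $0\le_H\varphi(a)$ holds if and only if $0\le_G na$ for some integer $n\ge1$. More precisely, for $a_1,\dots,a_k,b_1,\dots,b_\ell\in G$ (with $k,\ell\ge1$), $\varphi(a_1)\wedge\dots\wedge\varphi(a_k)\le_H\varphi(b_1)\vee\dots\vee\varphi(b_\ell)$ holds if and only if there are integers $n_1,\dots,n_k,m_1,\dots,m_\ell\ge0$ with $n_1+\dots+n_k=m_1+\dots+m_\ell\ge1$ such that $n_1a_1+\dots+n_ka_k\le_G m_1b_1+\dots+m_\ell b_\ell$. Moreover, $H$ can be constructed as the Lorenzen group associated with the finest system of ideals $\rhd_{\mathrm s}$ for $G$, defined by $A\rhd_{\mathrm s}b$ iff $a\le_G b$ for some $a\in A$.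
   Context: Groups are commutative. An ordered group is a commutative group with a partial order compatible with addition; a lattice-ordered group is an ordered group whose order is a lattice and addition distributes over meet and join. The lattice-ordered group freely generated by $G$ is given by the left adjoint of the forgetful functor from lattice-ordered groups to ordered groups. $\mathrm{P}_{\mathrm{fe}}^*(G)$ denotes the nonempty finite subsets of $G$, $A-B=\{a-b\}$. A system of ideals for $G$ is a relation $\rhd$ between $\mathrm{P}_{\mathrm{fe}}^*(G)$ and $G$ with $a\rhd a$; $A\rhd b\Rightarrow A\cup A'\rhd b$; ($A\rhd c$ and $A\cup\{c\}\rhd b$) $\Rightarrow A\rhd b$; $a\le_G b\Rightarrow a\rhd b$; $A\rhd b\Rightarrow x+A\rhd x+b$. For $y_i\in G$, $\rhd_{y_1,\dots,y_n}$ is the finest system of ideals coarser than $\rhd$ with $0\rhd_{y_1,\dots,y_n} y_i$ for all $i$. The regularisation: $A\vdash_\rhd B$ iff there exist $x_1,\dots,x_m\in G$ such that $A-B\rhd_{\pm x_1,\dots,\pm x_m}0$ for every choice of signs. The Lorenzen group associated with $\rhd$ is the distributive lattice presented by generators the elements of $G$ and relations $\bigwedge A\le\bigvee B$ whenever $A\vdash_\rhd B$, equipped with the unique group law compatible with the lattice operations making $G\to H$ a group morphism. *)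

theory Defs
  imports "HOL-Algebra.FiniteProduct" "HOL-Algebra.Coset" "HOL-Algebra.Lattice"
begin

section \<open>Ordered groups and lattice-ordered groups\<close>

text \<open>
  Commutative groups are written multiplicatively, as in HOL-Algebra: \<open>\<otimes>\<close>, \<open>\<one>\<close>, \<open>inv x\<close> and
  \<open>x [^] n\<close> stand for addition, \<open>0\<close>, \<open>- x\<close> and \<open>n x\<close> in the additive notation.
\<close>

record 'a ogroup = "'a monoid" +
  ole :: "'a \<Rightarrow> 'a \<Rightarrow> bool"  (infixl "\<preceq>\<index>" 50)

text \<open>The underlying ordered set, giving access to the order-theoretic notions of HOL-Algebra.\<close>

definition poset_of :: "'a ogroup \<Rightarrow> 'a gorder" where
  "poset_of G = \<lparr>carrier = carrier G, eq = (=), le = ole G\<rparr>"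

locale ordered_group = comm_group G for G :: "'a ogroup" (structure) +
  assumes partial_order: "partial_order (poset_of G)"
    and mult_mono: "\<lbrakk>x \<in> carrier G; y \<in> carrier G; z \<in> carrier G; x \<preceq> y\<rbrakk> \<Longrightarrow> z \<otimes> x \<preceq> z \<otimes> y"

locale l_group = ordered_group G for G :: "'a ogroup" (structure) +
  assumes lattice: "lattice (poset_of G)"
    and mult_meet: "\<lbrakk>x \<in> carrier G; y \<in> carrier G; z \<in> carrier G\<rbrakk> \<Longrightarrow>
      z \<otimes> (x \<sqinter>\<^bsub>poset_of G\<^esub> y) = (z \<otimes> x) \<sqinter>\<^bsub>poset_of G\<^esub> (z \<otimes> y)"
    and mult_join: "\<lbrakk>x \<in> carrier G; y \<in> carrier G; z \<in> carrier G\<rbrakk> \<Longrightarrow>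
      z \<otimes> (x \<squnion>\<^bsub>poset_of G\<^esub> y) = (z \<otimes> x) \<squnion>\<^bsub>poset_of G\<^esub> (z \<otimes> y)"

definition ogroup_hom :: "'a ogroup \<Rightarrow> 'b ogroup \<Rightarrow> ('a \<Rightarrow> 'b) set" where
  "ogroup_hom G H = {f \<in> hom G H. isotone (poset_of G) (poset_of H) f}"

definition l_group_hom :: "'a ogroup \<Rightarrow> 'b ogroup \<Rightarrow> ('a \<Rightarrow> 'b) set" where
  "l_group_hom G H = {f \<in> hom G H. \<forall>x\<in>carrier G. \<forall>y\<in>carrier G.
      f (x \<sqinter>\<^bsub>poset_of G\<^esub> y) = f x \<sqinter>\<^bsub>poset_of H\<^esub> f y \<and>
      f (x \<squnion>\<^bsub>poset_of G\<^esub> y) = f x \<squnion>\<^bsub>poset_of H\<^esub> f y}"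

text \<open>
  The universal property of the unit \<open>\<phi> : G \<rightarrow> H\<close> of the left adjoint of the forgetful functor from
  lattice-ordered groups to ordered groups, tested against the lattice-ordered groups \<open>L\<close> whose
  carrier is a set of elements of type \<open>'u\<close>. A formula cannot quantify over types, so the full
  universal property is this property for all types \<open>'u\<close>. Mediating morphisms are functions on
  \<open>carrier H\<close>, extended by \<open>undefined\<close> outside it so that uniqueness makes sense.
\<close>

definition freely_generated :: "'u itself \<Rightarrow> 'a ogroup \<Rightarrow> 'h ogroup \<Rightarrow> ('a \<Rightarrow> 'h) \<Rightarrow> bool" where
  "freely_generated (_ :: 'u itself) G H \<phi> \<longleftrightarrow>
     l_group H \<and> \<phi> \<in> ogroup_hom G H \<and>
     (\<forall>(L :: 'u ogroup) f. l_group L \<longrightarrow> f \<in> ogroup_hom G L \<longrightarrow>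
        (\<exists>!g. g \<in> l_group_hom H L \<and> g \<in> extensional (carrier H) \<and>
              (\<forall>x\<in>carrier G. g (\<phi> x) = f x)))"

section \<open>Systems of ideals and their regularisation\<close>

definition Pfe :: "'a ogroup \<Rightarrow> 'a set set" where
  "Pfe G = {A. A \<subseteq> carrier G \<and> finite A \<and> A \<noteq> {}}"

definition system_of_ideals :: "'a ogroup \<Rightarrow> ('a set \<Rightarrow> 'a \<Rightarrow> bool) \<Rightarrow> bool" where
  "system_of_ideals G R \<longleftrightarrow>
     (\<forall>A b. R A b \<longrightarrow> A \<in> Pfe G \<and> b \<in> carrier G) \<and>
     (\<forall>a\<in>carrier G. R {a} a) \<and>
     (\<forall>A\<in>Pfe G. \<forall>A'\<in>Pfe G. \<forall>b\<in>carrier G. R A b \<longrightarrow> R (A \<union> A') b) \<and>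
     (\<forall>A\<in>Pfe G. \<forall>b\<in>carrier G. \<forall>c\<in>carrier G. R A c \<longrightarrow> R (A \<union> {c}) b \<longrightarrow> R A b) \<and>
     (\<forall>a\<in>carrier G. \<forall>b\<in>carrier G. a \<preceq>\<^bsub>G\<^esub> b \<longrightarrow> R {a} b) \<and>
     (\<forall>A\<in>Pfe G. \<forall>b\<in>carrier G. \<forall>x\<in>carrier G. R A b \<longrightarrow> R (x <#\<^bsub>G\<^esub> A) (x \<otimes>\<^bsub>G\<^esub> b))"

text \<open>
  Relations are ordered by inclusion; a finer relation is a smaller one, so the finest system of
  ideals with a given property is the least one.
\<close>

definition forcing :: "'a ogroup \<Rightarrow> ('a set \<Rightarrow> 'a \<Rightarrow> bool) \<Rightarrow> 'a list \<Rightarrow> 'a set \<Rightarrow> 'a \<Rightarrow> bool" where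
  "forcing G R ys = (LEAST S. system_of_ideals G S \<and> R \<le> S \<and> (\<forall>y\<in>set ys. S {\<one>\<^bsub>G\<^esub>} y))"

text \<open>
  The list \<open>ys\<close> below is \<open>\<plusminus>x\<^sub>1, \<dots>, \<plusminus>x\<^sub>m\<close> for a choice of signs, and \<open>A <#> set_inv B\<close> is \<open>A - B\<close>.
\<close>

definition regularisation ::
    "'a ogroup \<Rightarrow> ('a set \<Rightarrow> 'a \<Rightarrow> bool) \<Rightarrow> 'a set \<Rightarrow> 'a set \<Rightarrow> bool" where
  "regularisation G R A B \<longleftrightarrow>
     A \<in> Pfe G \<and> B \<in> Pfe G \<and>
     (\<exists>xs. set xs \<subseteq> carrier G \<and>
        (\<forall>ys. list_all2 (\<lambda>x y. y = x \<or> y = inv\<^bsub>G\<^esub> x) xs ys \<longrightarrow>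
           forcing G R ys (A <#>\<^bsub>G\<^esub> set_inv\<^bsub>G\<^esub> B) \<one>\<^bsub>G\<^esub>))"

definition rhd_s :: "'a ogroup \<Rightarrow> 'a set \<Rightarrow> 'a \<Rightarrow> bool" where
  "rhd_s G A b \<longleftrightarrow> A \<in> Pfe G \<and> b \<in> carrier G \<and> (\<exists>a\<in>A. a \<preceq>\<^bsub>G\<^esub> b)"

section \<open>The distributive lattice presented by generators and relations\<close>

text \<open>
  It is the set of lattice terms over the generators, modulo the congruence of the least preorder
  that satisfies the laws of distributive lattices and the relations \<open>\<And>A \<le> \<Or>B\<close> for \<open>A \<turnstile> B\<close>.
  Lattices have no top or bottom in general, and \<open>A\<close> and \<open>B\<close> are nonempty. As a term, the meet of a
  finite set depends on an enumeration of it, so the relations are imposed for all enumerations.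
\<close>

datatype (gens: 'a) lterm = Gen 'a | Meet "'a lterm" "'a lterm" | Join "'a lterm" "'a lterm"

fun Meets :: "'a \<Rightarrow> 'a list \<Rightarrow> 'a lterm" where
  "Meets a [] = Gen a"
| "Meets a (b # bs) = Meet (Gen a) (Meets b bs)"

fun Joins :: "'a \<Rightarrow> 'a list \<Rightarrow> 'a lterm" where
  "Joins a [] = Gen a"
| "Joins a (b # bs) = Join (Gen a) (Joins b bs)"

definition lterms :: "'a set \<Rightarrow> 'a lterm set" where
  "lterms X = {t. gens t \<subseteq> X}"

inductive lterm_le :: "'a set \<Rightarrow> ('a set \<Rightarrow> 'a set \<Rightarrow> bool) \<Rightarrow> 'a lterm \<Rightarrow> 'a lterm \<Rightarrow> bool"
  for X :: "'a set" and E :: "'a set \<Rightarrow> 'a set \<Rightarrow> bool" where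
  refl: "s \<in> lterms X \<Longrightarrow> lterm_le X E s s"
| trans: "lterm_le X E s t \<Longrightarrow> lterm_le X E t u \<Longrightarrow> lterm_le X E s u"
| meet_left: "s \<in> lterms X \<Longrightarrow> t \<in> lterms X \<Longrightarrow> lterm_le X E (Meet s t) s"
| meet_right: "s \<in> lterms X \<Longrightarrow> t \<in> lterms X \<Longrightarrow> lterm_le X E (Meet s t) t"
| meet_greatest: "lterm_le X E u s \<Longrightarrow> lterm_le X E u t \<Longrightarrow> lterm_le X E u (Meet s t)"
| join_left: "s \<in> lterms X \<Longrightarrow> t \<in> lterms X \<Longrightarrow> lterm_le X E s (Join s t)"
| join_right: "s \<in> lterms X \<Longrightarrow> t \<in> lterms X \<Longrightarrow> lterm_le X E t (Join s t)"
| join_least: "lterm_le X E s u \<Longrightarrow> lterm_le X E t u \<Longrightarrow> lterm_le X E (Join s t) u"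
| distrib: "s \<in> lterms X \<Longrightarrow> t \<in> lterms X \<Longrightarrow> u \<in> lterms X \<Longrightarrow>
    lterm_le X E (Meet s (Join t u)) (Join (Meet s t) (Meet s u))"
| relation: "set (a # as) \<subseteq> X \<Longrightarrow> set (b # bs) \<subseteq> X \<Longrightarrow> E (set (a # as)) (set (b # bs)) \<Longrightarrow>
    lterm_le X E (Meets a as) (Joins b bs)"

definition lterm_cong :: "'a set \<Rightarrow> ('a set \<Rightarrow> 'a set \<Rightarrow> bool) \<Rightarrow> 'a lterm rel" where
  "lterm_cong X E = {(s, t). lterm_le X E s t \<and> lterm_le X E t s}"

definition presented_lattice ::
    "'a set \<Rightarrow> ('a set \<Rightarrow> 'a set \<Rightarrow> bool) \<Rightarrow> 'a lterm set gorder" where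
  "presented_lattice X E =
     \<lparr>carrier = lterms X // lterm_cong X E, eq = (=),
      le = (\<lambda>P Q. \<exists>s\<in>P. \<exists>t\<in>Q. lterm_le X E s t)\<rparr>"

section \<open>The Lorenzen group\<close>

definition lorenzen_lattice :: "'a ogroup \<Rightarrow> ('a set \<Rightarrow> 'a \<Rightarrow> bool) \<Rightarrow> 'a lterm set gorder" where
  "lorenzen_lattice G R = presented_lattice (carrier G) (regularisation G R)"

definition lorenzen_gen :: "'a ogroup \<Rightarrow> ('a set \<Rightarrow> 'a \<Rightarrow> bool) \<Rightarrow> 'a \<Rightarrow> 'a lterm set" where
  "lorenzen_gen G R a = lterm_cong (carrier G) (regularisation G R) `` {Gen a}"

text \<open>
  The group law is characterised, not constructed: it is compatible with the lattice operations and
  makes the map from \<open>G\<close> a group morphism. These conditions determine it on the carrier.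
\<close>

definition lorenzen_group ::
    "'a ogroup \<Rightarrow> ('a set \<Rightarrow> 'a \<Rightarrow> bool) \<Rightarrow> 'a lterm set ogroup \<Rightarrow> bool" where
  "lorenzen_group G R L \<longleftrightarrow>
     l_group L \<and> poset_of L = lorenzen_lattice G R \<and> lorenzen_gen G R \<in> hom G L"

end

theory Submission
  imports Defs
begin

text \<open>
  Adjoining \<open>y\<close> to a system of ideals that is given by a cone amounts to adjoining \<open>y\<close> to the cone,
  and eliminating a pair \<open>\<plusminus>x\<close> amounts to cancelling \<open>x\<close> between two inequalities. So \<open>A \<turnstile> B\<close> holds
  for the regularisation of the finest system iff some element of the semigroup generated by
  \<open>A - B\<close> is \<open>\<le> 0\<close>. If there is none, Zorn's lemma gives a total group preorder, extending the order
  of \<open>G\<close>, in which every element of \<open>A - B\<close> is positive. Hence an inequality between lattice terms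
  is derivable iff it holds in all total group preorders extending the order, where meet and join are
  minimum and maximum. This makes the multiplication of terms well defined on the Lorenzen lattice,
  and makes it a lattice-ordered group. It is free because \<open>n x \<le> n y\<close> with \<open>n \<ge> 1\<close> implies \<open>x \<le> y\<close>
  in every lattice-ordered group, so that the relations \<open>\<And>A \<le> \<Or>B\<close> hold there.
\<close>

text \<open>The regularisation quantifies over all choices of signs and, for each, over a least
  system of ideals, so it has no evident closure properties. Replacing it by one inequality in the
  semigroup generated by \<open>A - B\<close> makes it arithmetic. A product of N factors from
  \<open>A - B\<close> uses N elements of \<open>A\<close> and N elements of \<open>B\<close>: this
  is the origin of the equal sums of multiplicities, and the absence of the empty product is the
  origin of the bound 1. Total preorders have to be used instead of total orders because
  \<open>G\<close> may have torsion. A further obstacle is that a Lorenzen group is characterised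
  and not constructed, so freeness has to be shown for every group law allowed on the lattice. One
  computation settles this: interpreting terms in a lattice-ordered group turns \<open>tmult\<close>
  into the product. It determines the law, and it also makes the mediating map a group morphism.
  Inequalities in \<open>H\<close> itself are not analysed: the universal property transports them
  to the model, where they are decided by total cones.\<close>

lemma poset_of_simps [simp]:
  "carrier (poset_of G) = carrier G" "gorder.le (poset_of G) = ole G" "x .=\<^bsub>poset_of G\<^esub> y \<longleftrightarrow> x = y"
  by (simp_all add: poset_of_def)

section \<open>Ordered groups and lattice-ordered groups\<close>

context ordered_group
begin

lemma inv_cancel_left [simp]:
  assumes "x \<in> carrier G" "y \<in> carrier G"
  shows "inv x \<otimes> (x \<otimes> y) = y" "x \<otimes> (inv x \<otimes> y) = y"
  using assms by (simp_all add: m_assoc[symmetric])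

lemma le_refl: "x \<in> carrier G \<Longrightarrow> x \<preceq> x"
  using weak_partial_order.le_refl[OF partial_order.axioms(1)[OF partial_order]] by simp

lemma le_antisym: "x \<preceq> y \<Longrightarrow> y \<preceq> x \<Longrightarrow> x \<in> carrier G \<Longrightarrow> y \<in> carrier G \<Longrightarrow> x = y"
  using weak_partial_order.weak_le_antisym[OF partial_order.axioms(1)[OF partial_order]] by simp

lemma le_trans: "x \<preceq> y \<Longrightarrow> y \<preceq> z \<Longrightarrow> x \<in> carrier G \<Longrightarrow> y \<in> carrier G \<Longrightarrow> z \<in> carrier G \<Longrightarrow> x \<preceq> z"
  using weak_partial_order.le_trans[OF partial_order.axioms(1)[OF partial_order]] by simp

lemma mult_le_cancel_left:
  assumes "x \<in> carrier G" "y \<in> carrier G" "z \<in> carrier G"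
  shows "z \<otimes> x \<preceq> z \<otimes> y \<longleftrightarrow> x \<preceq> y"
  using mult_mono[of x y z] mult_mono[of "z \<otimes> x" "z \<otimes> y" "inv z"] assms
  by auto

lemma le_inv_mult_iff:
  assumes "x \<in> carrier G" "y \<in> carrier G" "z \<in> carrier G"
  shows "x \<preceq> inv z \<otimes> y \<longleftrightarrow> z \<otimes> x \<preceq> y"
  using mult_le_cancel_left[of x "inv z \<otimes> y" z] assms by simp

lemma inv_mult_le_iff:
  assumes "x \<in> carrier G" "y \<in> carrier G" "z \<in> carrier G"
  shows "inv z \<otimes> x \<preceq> y \<longleftrightarrow> x \<preceq> z \<otimes> y"
  using mult_le_cancel_left[of "inv z \<otimes> x" y z] assms by simp

lemma mult_le_mult:
  assumes "x \<preceq> y" "u \<preceq> v" "x \<in> carrier G" "y \<in> carrier G" "u \<in> carrier G" "v \<in> carrier G"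
  shows "x \<otimes> u \<preceq> y \<otimes> v"
proof -
  have "x \<otimes> u \<preceq> x \<otimes> v" "v \<otimes> x \<preceq> v \<otimes> y"
    using assms mult_mono by auto
  then show ?thesis
    using assms le_trans by (simp add: m_comm[of v])
qed

lemma le_iff_one_le:
  assumes "x \<in> carrier G" "y \<in> carrier G"
  shows "x \<preceq> y \<longleftrightarrow> \<one> \<preceq> inv x \<otimes> y"
  using mult_le_cancel_left[of x y "inv x"] assms by simp

lemma nat_pow_mono:
  assumes "x \<preceq> y" "x \<in> carrier G" "y \<in> carrier G"
  shows "x [^] (n::nat) \<preceq> y [^] n"
  by (induction n) (use assms in \<open>auto intro: mult_le_mult le_refl\<close>)

text \<open>To be applied with \<open>x\<close> the meet of the \<open>\<phi> (a i)\<close>: the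
  weights are gathered in the exponent of a single element, which can then be cancelled by
  \<open>le_of_pow_le_pow\<close>. The next lemma does the same for the join.\<close>

lemma pow_sum_le_finprod:
  fixes n :: "nat \<Rightarrow> nat"
  assumes "x \<in> carrier G" "c \<in> {..<k} \<rightarrow> carrier G" "\<And>i. i < k \<Longrightarrow> x \<preceq> c i"
  shows "x [^] (\<Sum>i<k. n i) \<preceq> (\<Otimes>i\<in>{..<k}. c i [^] n i)"
  using assms
proof (induction k)
  case (Suc k)
  have "c \<in> {..<k} \<rightarrow> carrier G" "c k \<in> carrier G" using Suc.prems by auto
  then have "x [^] (\<Sum>i<k. n i) \<otimes> x [^] n k \<preceq> (\<Otimes>i\<in>{..<k}. c i [^] n i) \<otimes> c k [^] n k"
    using Suc by (intro mult_le_mult nat_pow_mono) (auto intro!: finprod_closed)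
  then show ?case
    using Suc.prems by (subst lessThan_Suc, subst finprod_insert)
      (auto simp: nat_pow_mult m_comm finprod_closed Pi_iff add.commute)
qed (simp add: le_refl)

lemma finprod_le_pow_sum:
  fixes n :: "nat \<Rightarrow> nat"
  assumes "x \<in> carrier G" "c \<in> {..<k} \<rightarrow> carrier G" "\<And>i. i < k \<Longrightarrow> c i \<preceq> x"
  shows "(\<Otimes>i\<in>{..<k}. c i [^] n i) \<preceq> x [^] (\<Sum>i<k. n i)"
  using assms
proof (induction k)
  case (Suc k)
  have "c \<in> {..<k} \<rightarrow> carrier G" "c k \<in> carrier G" using Suc.prems by auto
  then have "(\<Otimes>i\<in>{..<k}. c i [^] n i) \<otimes> c k [^] n k \<preceq> x [^] (\<Sum>i<k. n i) \<otimes> x [^] n k"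
    using Suc by (intro mult_le_mult nat_pow_mono) (auto intro!: finprod_closed)
  then show ?case
    using Suc.prems by (subst lessThan_Suc, subst finprod_insert)
      (auto simp: nat_pow_mult m_comm finprod_closed Pi_iff add.commute)
qed (simp add: le_refl)

end

section \<open>Lattice-ordered groups: distributivity and extraction of roots\<close>

context l_group
begin

lemma meet_closed [simp]: "x \<in> carrier G \<Longrightarrow> y \<in> carrier G \<Longrightarrow> x \<sqinter>\<^bsub>poset_of G\<^esub> y \<in> carrier G"
  and meet_left: "x \<in> carrier G \<Longrightarrow> y \<in> carrier G \<Longrightarrow> x \<sqinter>\<^bsub>poset_of G\<^esub> y \<preceq> x"
  and meet_right: "x \<in> carrier G \<Longrightarrow> y \<in> carrier G \<Longrightarrow> x \<sqinter>\<^bsub>poset_of G\<^esub> y \<preceq> y"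
  and meet_greatest: "z \<preceq> x \<Longrightarrow> z \<preceq> y \<Longrightarrow> x \<in> carrier G \<Longrightarrow> y \<in> carrier G \<Longrightarrow> z \<in> carrier G \<Longrightarrow>
    z \<preceq> x \<sqinter>\<^bsub>poset_of G\<^esub> y"
  and join_closed [simp]: "x \<in> carrier G \<Longrightarrow> y \<in> carrier G \<Longrightarrow> x \<squnion>\<^bsub>poset_of G\<^esub> y \<in> carrier G"
  and join_left: "x \<in> carrier G \<Longrightarrow> y \<in> carrier G \<Longrightarrow> x \<preceq> x \<squnion>\<^bsub>poset_of G\<^esub> y"
  and join_right: "x \<in> carrier G \<Longrightarrow> y \<in> carrier G \<Longrightarrow> y \<preceq> x \<squnion>\<^bsub>poset_of G\<^esub> y"
  and join_least: "x \<preceq> z \<Longrightarrow> y \<preceq> z \<Longrightarrow> x \<in> carrier G \<Longrightarrow> y \<in> carrier G \<Longrightarrow> z \<in> carrier G \<Longrightarrow>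
    x \<squnion>\<^bsub>poset_of G\<^esub> y \<preceq> z"
proof -
  interpret L: lattice "poset_of G" by (rule lattice)
  show "x \<in> carrier G \<Longrightarrow> y \<in> carrier G \<Longrightarrow> x \<sqinter>\<^bsub>poset_of G\<^esub> y \<in> carrier G"
    "x \<in> carrier G \<Longrightarrow> y \<in> carrier G \<Longrightarrow> x \<sqinter>\<^bsub>poset_of G\<^esub> y \<preceq> x"
    "x \<in> carrier G \<Longrightarrow> y \<in> carrier G \<Longrightarrow> x \<sqinter>\<^bsub>poset_of G\<^esub> y \<preceq> y"
    "z \<preceq> x \<Longrightarrow> z \<preceq> y \<Longrightarrow> x \<in> carrier G \<Longrightarrow> y \<in> carrier G \<Longrightarrow> z \<in> carrier G \<Longrightarrow>
      z \<preceq> x \<sqinter>\<^bsub>poset_of G\<^esub> y"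
    "x \<in> carrier G \<Longrightarrow> y \<in> carrier G \<Longrightarrow> x \<squnion>\<^bsub>poset_of G\<^esub> y \<in> carrier G"
    "x \<in> carrier G \<Longrightarrow> y \<in> carrier G \<Longrightarrow> x \<preceq> x \<squnion>\<^bsub>poset_of G\<^esub> y"
    "x \<in> carrier G \<Longrightarrow> y \<in> carrier G \<Longrightarrow> y \<preceq> x \<squnion>\<^bsub>poset_of G\<^esub> y"
    "x \<preceq> z \<Longrightarrow> y \<preceq> z \<Longrightarrow> x \<in> carrier G \<Longrightarrow> y \<in> carrier G \<Longrightarrow> z \<in> carrier G \<Longrightarrow>
      x \<squnion>\<^bsub>poset_of G\<^esub> y \<preceq> z"
    using L.meet_closed[of x y] L.meet_left[of x y] L.meet_right[of x y] L.meet_le[of z x y]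
      L.join_closed[of x y] L.join_left[of x y] L.join_right[of x y] L.join_le[of x z y]
    by simp_all
qed

lemma finite_inf_closed: "finite A \<Longrightarrow> A \<subseteq> carrier G \<Longrightarrow> A \<noteq> {} \<Longrightarrow> \<Sqinter>\<^bsub>poset_of G\<^esub>A \<in> carrier G"
  and finite_inf_lower: "finite A \<Longrightarrow> A \<subseteq> carrier G \<Longrightarrow> x \<in> A \<Longrightarrow> \<Sqinter>\<^bsub>poset_of G\<^esub>A \<preceq> x"
  and finite_inf_greatest: "finite A \<Longrightarrow> A \<subseteq> carrier G \<Longrightarrow> A \<noteq> {} \<Longrightarrow> z \<in> carrier G \<Longrightarrow>
    (\<And>x. x \<in> A \<Longrightarrow> z \<preceq> x) \<Longrightarrow> z \<preceq> \<Sqinter>\<^bsub>poset_of G\<^esub>A"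
  and finite_sup_closed: "finite A \<Longrightarrow> A \<subseteq> carrier G \<Longrightarrow> A \<noteq> {} \<Longrightarrow> \<Squnion>\<^bsub>poset_of G\<^esub>A \<in> carrier G"
  and finite_sup_upper: "finite A \<Longrightarrow> A \<subseteq> carrier G \<Longrightarrow> x \<in> A \<Longrightarrow> x \<preceq> \<Squnion>\<^bsub>poset_of G\<^esub>A"
  and finite_sup_least: "finite A \<Longrightarrow> A \<subseteq> carrier G \<Longrightarrow> A \<noteq> {} \<Longrightarrow> z \<in> carrier G \<Longrightarrow>
    (\<And>x. x \<in> A \<Longrightarrow> x \<preceq> z) \<Longrightarrow> \<Squnion>\<^bsub>poset_of G\<^esub>A \<preceq> z"
proof -
  interpret L: lattice "poset_of G" by (rule lattice)
  show "finite A \<Longrightarrow> A \<subseteq> carrier G \<Longrightarrow> A \<noteq> {} \<Longrightarrow> \<Sqinter>\<^bsub>poset_of G\<^esub>A \<in> carrier G"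
    "finite A \<Longrightarrow> A \<subseteq> carrier G \<Longrightarrow> A \<noteq> {} \<Longrightarrow> \<Squnion>\<^bsub>poset_of G\<^esub>A \<in> carrier G"
    using L.finite_inf_closed[of A] L.finite_sup_closed[of A] by simp_all
  show "finite A \<Longrightarrow> A \<subseteq> carrier G \<Longrightarrow> x \<in> A \<Longrightarrow> \<Sqinter>\<^bsub>poset_of G\<^esub>A \<preceq> x"
    "finite A \<Longrightarrow> A \<subseteq> carrier G \<Longrightarrow> A \<noteq> {} \<Longrightarrow> z \<in> carrier G \<Longrightarrow>
      (\<And>x. x \<in> A \<Longrightarrow> z \<preceq> x) \<Longrightarrow> z \<preceq> \<Sqinter>\<^bsub>poset_of G\<^esub>A"
    using L.finite_inf_greatest[of A] by (auto simp: greatest_def Lower_def)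
  show "finite A \<Longrightarrow> A \<subseteq> carrier G \<Longrightarrow> x \<in> A \<Longrightarrow> x \<preceq> \<Squnion>\<^bsub>poset_of G\<^esub>A"
    "finite A \<Longrightarrow> A \<subseteq> carrier G \<Longrightarrow> A \<noteq> {} \<Longrightarrow> z \<in> carrier G \<Longrightarrow>
      (\<And>x. x \<in> A \<Longrightarrow> x \<preceq> z) \<Longrightarrow> \<Squnion>\<^bsub>poset_of G\<^esub>A \<preceq> z"
    using L.finite_sup_least[of A] by (auto simp: least_def Upper_def)
qed

lemma le_meet_iff:
  assumes "x \<in> carrier G" "y \<in> carrier G" "z \<in> carrier G"
  shows "z \<preceq> x \<sqinter>\<^bsub>poset_of G\<^esub> y \<longleftrightarrow> z \<preceq> x \<and> z \<preceq> y"
  using assms meet_left meet_right meet_greatest le_trans meet_closed by metis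

text \<open>The map sending \<open>t\<close> to \<open>inv t \<otimes> (x \<otimes> y)\<close>
  reverses the order and exchanges \<open>x\<close> and \<open>y\<close>, so it must exchange their
  meet and their join. The two inequalities come from the bounds that it provides.\<close>

lemma meet_times_join:
  assumes "x \<in> carrier G" "y \<in> carrier G"
  shows "(x \<sqinter>\<^bsub>poset_of G\<^esub> y) \<otimes> (x \<squnion>\<^bsub>poset_of G\<^esub> y) = x \<otimes> y"
proof -
  define m where "m = x \<sqinter>\<^bsub>poset_of G\<^esub> y"
  define j where "j = x \<squnion>\<^bsub>poset_of G\<^esub> y"
  have c: "m \<in> carrier G" "j \<in> carrier G" using assms by (simp_all add: m_def j_def)
  have "m \<preceq> x" "m \<preceq> y" using assms by (simp_all add: m_def meet_left meet_right)
  then have "m \<otimes> x \<preceq> y \<otimes> x" "m \<otimes> y \<preceq> x \<otimes> y"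
    using assms c by (auto intro: mult_le_mult le_refl)
  then have "x \<preceq> inv m \<otimes> (x \<otimes> y)" "y \<preceq> inv m \<otimes> (x \<otimes> y)"
    using assms c by (simp_all add: le_inv_mult_iff m_comm[of y x])
  then have "j \<preceq> inv m \<otimes> (x \<otimes> y)"
    using assms c unfolding j_def by (intro join_least) auto
  then have 1: "m \<otimes> j \<preceq> x \<otimes> y"
    using assms c by (simp add: le_inv_mult_iff)
  have "x \<preceq> j" "y \<preceq> j" using assms by (simp_all add: j_def join_left join_right)
  then have "x \<otimes> y \<preceq> j \<otimes> y" "y \<otimes> x \<preceq> j \<otimes> x"
    using assms c by (auto intro: mult_le_mult le_refl)
  then have "inv j \<otimes> (x \<otimes> y) \<preceq> x" "inv j \<otimes> (x \<otimes> y) \<preceq> y"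
    using assms c by (simp_all add: inv_mult_le_iff m_comm[of y x])
  then have "inv j \<otimes> (x \<otimes> y) \<preceq> m"
    using assms c unfolding m_def by (intro meet_greatest) auto
  then have 2: "x \<otimes> y \<preceq> m \<otimes> j"
    using assms c by (simp add: inv_mult_le_iff m_comm[of m j])
  show ?thesis using 1 2 assms c le_antisym by (simp add: m_def j_def)
qed

text \<open>By \<open>meet_times_join\<close>, the product of \<open>x \<sqinter> v\<close> and
  \<open>w\<close> is \<open>x \<otimes> v\<close>. Hence the claim amounts to
  \<open>v \<preceq> inv x \<otimes> (u \<otimes> w)\<close>, an upper bound for the join
  \<open>v\<close>, which can be checked on \<open>y\<close> and \<open>z\<close>
  separately.\<close>

lemma distributive:
  assumes "x \<in> carrier G" "y \<in> carrier G" "z \<in> carrier G"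
  shows "x \<sqinter>\<^bsub>poset_of G\<^esub> (y \<squnion>\<^bsub>poset_of G\<^esub> z)
    \<preceq> (x \<sqinter>\<^bsub>poset_of G\<^esub> y) \<squnion>\<^bsub>poset_of G\<^esub> (x \<sqinter>\<^bsub>poset_of G\<^esub> z)"
proof -
  define v where "v = y \<squnion>\<^bsub>poset_of G\<^esub> z"
  define u where "u = (x \<sqinter>\<^bsub>poset_of G\<^esub> y) \<squnion>\<^bsub>poset_of G\<^esub> (x \<sqinter>\<^bsub>poset_of G\<^esub> z)"
  define w where "w = x \<squnion>\<^bsub>poset_of G\<^esub> v"
  have c: "v \<in> carrier G" "u \<in> carrier G" "w \<in> carrier G"
    using assms by (simp_all add: v_def u_def w_def)
  have key: "t \<preceq> inv x \<otimes> (u \<otimes> w)"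
    if "t \<in> carrier G" "x \<sqinter>\<^bsub>poset_of G\<^esub> t \<preceq> u" "t \<preceq> v" for t
  proof -
    have "x \<squnion>\<^bsub>poset_of G\<^esub> t \<preceq> w"
      using that assms c join_left[of x v] join_right[of x v] le_trans[of t v "x \<squnion>\<^bsub>poset_of G\<^esub> v"]
      by (auto simp: w_def intro!: join_least)
    then have "x \<otimes> t \<preceq> u \<otimes> w"
      using that assms c by (subst meet_times_join[symmetric]) (auto intro!: mult_le_mult)
    then show ?thesis using that assms c by (simp add: le_inv_mult_iff)
  qed
  have "v \<preceq> inv x \<otimes> (u \<otimes> w)"
    using assms c unfolding v_def
    by (intro join_least key)
      (auto simp: u_def v_def intro: join_left join_right)
  then have "x \<otimes> v \<preceq> u \<otimes> w"
    using assms c by (simp add: le_inv_mult_iff)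
  then have "(x \<sqinter>\<^bsub>poset_of G\<^esub> v) \<otimes> w \<preceq> u \<otimes> w"
    using meet_times_join[of x v] assms c by (simp add: w_def)
  then show ?thesis
    using assms c mult_le_cancel_left[of "x \<sqinter>\<^bsub>poset_of G\<^esub> v" u w]
    by (simp add: m_comm u_def v_def)
qed

text \<open>
  The powers of \<open>u = x \<sqinter> \<one>\<close> satisfy \<open>u\<^sup>k = \<one> \<sqinter> x \<sqinter> \<dots> \<sqinter> x\<^sup>k\<close>, so that \<open>u\<^sup>n = u\<^sup>n\<^sup>-\<^sup>1\<close> once \<open>\<one> \<preceq> x\<^sup>n\<close>.
\<close>

lemma one_le_of_one_le_pow:
  assumes x: "x \<in> carrier G" and n: "n \<ge> 1" and le: "\<one> \<preceq> x [^] (n::nat)"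
  shows "\<one> \<preceq> x"
proof -
  define u where "u = x \<sqinter>\<^bsub>poset_of G\<^esub> \<one>"
  have u: "u \<in> carrier G" "u \<preceq> x" "u \<preceq> \<one>"
    using x by (simp_all add: u_def meet_left meet_right)
  have greatest: "z \<preceq> u [^] k" if "z \<in> carrier G" "\<And>j. j \<le> k \<Longrightarrow> z \<preceq> x [^] j" for z and k :: nat
    using that
  proof (induction k arbitrary: z)
    case 0
    then show ?case using 0(2)[of 0] by simp
  next
    case (Suc k)
    have "inv x \<otimes> z \<preceq> x [^] j" if "j \<le> k" for j
      using Suc.prems(1) Suc.prems(2)[of "Suc j"] that x by (simp add: inv_mult_le_iff m_comm[of x])
    then have "inv x \<otimes> z \<preceq> u [^] k" using Suc x by simp
    then have 1: "z \<preceq> u [^] k \<otimes> x" using Suc.prems(1) u x by (simp add: inv_mult_le_iff m_comm[of x])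
    have 2: "z \<preceq> u [^] k \<otimes> \<one>" using Suc u by simp
    have "u [^] Suc k = (u [^] k \<otimes> x) \<sqinter>\<^bsub>poset_of G\<^esub> (u [^] k \<otimes> \<one>)"
      using u x mult_meet[of x \<one> "u [^] k"] by (simp add: u_def)
    then show ?case using 1 2 Suc.prems u x by (metis le_meet_iff m_closed nat_pow_closed one_closed)
  qed
  obtain k where k: "n = Suc k" using n by (cases n) auto
  have pow1: "u [^] k \<preceq> \<one>"
    using nat_pow_mono[of u \<one> k] u by simp
  \<comment> \<open>Below the top exponent, \<open>x [^] j\<close> is bounded using
    \<open>u \<preceq> x\<close> for \<open>j\<close> factors and \<open>u \<preceq> \<one>\<close>
    for the others. At the top exponent the hypothesis puts \<open>\<one>\<close>, and so
    \<open>u [^] k\<close>, below \<open>x [^] n\<close>. Cancelling \<open>u [^] k\<close> then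
    leaves \<open>\<one> \<preceq> u\<close>.\<close>
  have "u [^] k \<preceq> u [^] Suc k"
  proof (rule greatest)
    fix j assume "j \<le> Suc k"
    show "u [^] k \<preceq> x [^] j"
    proof (cases "j = Suc k")
      case True
      then show ?thesis using pow1 le k u x le_trans[of "u [^] k" \<one> "x [^] j"] by simp
    next
      case False
      then have j: "(k - j) + j = k" using \<open>j \<le> Suc k\<close> by simp
      have "u [^] (k - j) \<otimes> u [^] j \<preceq> \<one> [^] (k - j) \<otimes> x [^] j"
        using u x by (intro mult_le_mult nat_pow_mono) auto
      then show ?thesis using u x j by (simp add: nat_pow_mult)
    qed
  qed (use u in simp)
  then have "u [^] k \<otimes> \<one> \<preceq> u [^] k \<otimes> u" using u by simp
  then have "\<one> \<preceq> u" using u mult_le_cancel_left[of \<one> u "u [^] k"] by simp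
  then show ?thesis using u x le_trans[of \<one> u x] by simp
qed

lemma le_of_pow_le_pow:
  assumes "x \<in> carrier G" "y \<in> carrier G" "n \<ge> 1" "x [^] (n::nat) \<preceq> y [^] n"
  shows "x \<preceq> y"
proof -
  have "\<one> \<preceq> inv (x [^] n) \<otimes> y [^] n"
    using assms le_iff_one_le[of "x [^] n" "y [^] n"] by simp
  also have "\<dots> = (inv x \<otimes> y) [^] n"
    using assms by (simp add: nat_pow_distrib nat_pow_inv)
  finally show ?thesis using assms one_le_of_one_le_pow[of "inv x \<otimes> y" n] le_iff_one_le[of x y] by simp
qed

end

section \<open>Cones and the regularisation\<close>

text \<open>A translation-invariant preorder containing the order of \<open>G\<close>, encoded by
  the elements above \<open>\<one>\<close>. The cone may contain elements other than
  \<open>\<one>\<close> together with their inverses, and it may be all of \<open>G\<close>.\<close>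

definition cone :: "'a ogroup \<Rightarrow> 'a set \<Rightarrow> bool" where
  "cone G P \<longleftrightarrow> P \<subseteq> carrier G \<and> {x \<in> carrier G. \<one>\<^bsub>G\<^esub> \<preceq>\<^bsub>G\<^esub> x} \<subseteq> P \<and>
     (\<forall>x\<in>P. \<forall>y\<in>P. x \<otimes>\<^bsub>G\<^esub> y \<in> P)"

definition adjoin :: "'a ogroup \<Rightarrow> 'a \<Rightarrow> 'a set \<Rightarrow> 'a set" where
  "adjoin G x P = {q \<otimes>\<^bsub>G\<^esub> x [^]\<^bsub>G\<^esub> (n::nat) | q n. q \<in> P}"

text \<open>Generators are adjoined one at a time, so that the head of the list can be eliminated
  over the cone of its tail.\<close>

definition cone_gen :: "'a ogroup \<Rightarrow> 'a list \<Rightarrow> 'a set" where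
  "cone_gen G ys = foldr (adjoin G) ys {x \<in> carrier G. \<one>\<^bsub>G\<^esub> \<preceq>\<^bsub>G\<^esub> x}"

text \<open>This is \<open>rhd_s\<close> with the order of \<open>G\<close> replaced by the preorder
  of \<open>P\<close>.\<close>

definition cone_ideals :: "'a ogroup \<Rightarrow> 'a set \<Rightarrow> 'a set \<Rightarrow> 'a \<Rightarrow> bool" where
  "cone_ideals G P A b \<longleftrightarrow> A \<in> Pfe G \<and> b \<in> carrier G \<and> (\<exists>a\<in>A. inv\<^bsub>G\<^esub> a \<otimes>\<^bsub>G\<^esub> b \<in> P)"

text \<open>A semigroup and not a monoid: the empty product \<open>\<one>\<close> would satisfy
  every test of the form \<open>d \<preceq> \<one>\<close>.\<close>

inductive_set semigroup_span :: "'a ogroup \<Rightarrow> 'a set \<Rightarrow> 'a set" for G D where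
  base: "d \<in> D \<Longrightarrow> d \<in> semigroup_span G D"
| mult: "d \<in> semigroup_span G D \<Longrightarrow> e \<in> semigroup_span G D \<Longrightarrow> d \<otimes>\<^bsub>G\<^esub> e \<in> semigroup_span G D"

lemma (in ordered_group) pow_in_semigroup_span:
  "d \<in> semigroup_span G D \<Longrightarrow> d \<in> carrier G \<Longrightarrow> n \<ge> 1 \<Longrightarrow> d [^] (n::nat) \<in> semigroup_span G D"
proof (induction n)
  case (Suc n)
  then show ?case by (cases n) (auto intro: semigroup_span.mult)
qed simp

lemma Pfe_Un: "A \<in> Pfe G \<Longrightarrow> B \<in> Pfe G \<Longrightarrow> A \<union> B \<in> Pfe G"
  by (auto simp: Pfe_def)

lemma system_of_idealsD:
  assumes "system_of_ideals G S"
  shows "S A b \<Longrightarrow> A \<in> Pfe G" "S A b \<Longrightarrow> b \<in> carrier G"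
    "a \<in> carrier G \<Longrightarrow> S {a} a"
    "S A b \<Longrightarrow> A' \<in> Pfe G \<Longrightarrow> S (A \<union> A') b"
    "S A c \<Longrightarrow> S (A \<union> {c}) b \<Longrightarrow> S A b"
    "a \<in> carrier G \<Longrightarrow> b \<in> carrier G \<Longrightarrow> a \<preceq>\<^bsub>G\<^esub> b \<Longrightarrow> S {a} b"
    "S A b \<Longrightarrow> x \<in> carrier G \<Longrightarrow> S (x <#\<^bsub>G\<^esub> A) (x \<otimes>\<^bsub>G\<^esub> b)"
  using assms unfolding system_of_ideals_def by metis+

context ordered_group
begin

lemma Pfe_carrier: "A \<in> Pfe G \<Longrightarrow> a \<in> A \<Longrightarrow> a \<in> carrier G"
  by (auto simp: Pfe_def)

lemma semigroup_span_closed: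
  assumes "D \<subseteq> carrier G" "d \<in> semigroup_span G D"
  shows "d \<in> carrier G"
  using assms(2,1) by (induction rule: semigroup_span.induct) auto

lemma cone_positive: "cone G {x \<in> carrier G. \<one> \<preceq> x}"
proof -
  have "\<one> \<preceq> x \<otimes> y" if "x \<in> carrier G" "y \<in> carrier G" "\<one> \<preceq> x" "\<one> \<preceq> y" for x y
    using mult_le_mult[of \<one> x \<one> y] that by simp
  then show ?thesis by (simp add: cone_def)
qed

lemma cone_one: "cone G P \<Longrightarrow> \<one> \<in> P"
  by (auto simp: cone_def le_refl subset_iff)

lemma cone_carrier: "cone G P \<Longrightarrow> x \<in> P \<Longrightarrow> x \<in> carrier G"
  by (auto simp: cone_def)

lemma cone_mult: "cone G P \<Longrightarrow> x \<in> P \<Longrightarrow> y \<in> P \<Longrightarrow> x \<otimes> y \<in> P"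
  by (auto simp: cone_def)

lemma cone_pow: "cone G P \<Longrightarrow> x \<in> P \<Longrightarrow> x [^] (n::nat) \<in> P"
  by (induction n) (auto simp: cone_one intro: cone_mult)

lemma subset_adjoin:
  assumes "P \<subseteq> carrier G"
  shows "P \<subseteq> adjoin G x P"
proof
  fix q assume "q \<in> P"
  then have "q = q \<otimes> x [^] (0::nat)" using assms by auto
  then show "q \<in> adjoin G x P" using \<open>q \<in> P\<close> unfolding adjoin_def by blast
qed

lemma mem_adjoin:
  assumes "cone G P" "x \<in> carrier G"
  shows "x \<in> adjoin G x P"
proof -
  have "x = \<one> \<otimes> x [^] (1::nat)" using assms by auto
  then show ?thesis using cone_one[OF assms(1)] unfolding adjoin_def by blast
qed

lemma cone_adjoin:
  assumes P: "cone G P" and x: "x \<in> carrier G"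
  shows "cone G (adjoin G x P)"
proof -
  have "u \<otimes> v \<in> adjoin G x P" if uv: "u \<in> adjoin G x P" "v \<in> adjoin G x P" for u v
  proof -
    obtain q n r m where e: "u = q \<otimes> x [^] (n::nat)" "v = r \<otimes> x [^] (m::nat)" "q \<in> P" "r \<in> P"
      using uv by (auto simp: adjoin_def)
    have "u \<otimes> v = (q \<otimes> r) \<otimes> x [^] (n + m)"
      using e x cone_carrier[OF P] by (simp add: nat_pow_mult[symmetric] m_ac)
    then show ?thesis using cone_mult[OF P e(3,4)] unfolding adjoin_def by blast
  qed
  moreover have "adjoin G x P \<subseteq> carrier G"
    using x cone_carrier[OF P] by (auto simp: adjoin_def)
  ultimately show ?thesis
    using P subset_adjoin[of P x] unfolding cone_def by blast
qed

lemma cone_cone_gen: "set ys \<subseteq> carrier G \<Longrightarrow> cone G (cone_gen G ys)"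
  by (induction ys) (auto simp: cone_gen_def cone_positive cone_adjoin)

lemma set_subset_cone_gen: "set ys \<subseteq> carrier G \<Longrightarrow> set ys \<subseteq> cone_gen G ys"
proof (induction ys)
  case (Cons y ys)
  have c: "cone G (cone_gen G ys)" "y \<in> carrier G" using Cons.prems cone_cone_gen by auto
  have "cone_gen G (y # ys) = adjoin G y (cone_gen G ys)" by (simp add: cone_gen_def)
  then show ?case
    using Cons mem_adjoin[OF c] subset_adjoin[of "cone_gen G ys" y] c(1)
    by (auto simp: cone_def)
qed simp

lemma semigroup_span_subset_cone:
  assumes "cone G P" "D \<subseteq> P" "d \<in> semigroup_span G D"
  shows "d \<in> P"
  using assms(3,2) by (induction rule: semigroup_span.induct) (use assms(1) in \<open>auto simp: cone_def\<close>)

text \<open>Fourier-Motzkin elimination of \<open>x\<close>. If \<open>inv d\<close> is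
  \<open>q\<close> times the n-th power of \<open>x\<close>, and \<open>inv e\<close> is
  \<open>r\<close> times the m-th power of \<open>inv x\<close>, then the powers of \<open>x\<close>
  cancel in the inverse of \<open>d [^] m \<otimes> e [^] n\<close>, which is
  \<open>q [^] m \<otimes> r [^] n\<close>.\<close>

lemma eliminate:
  assumes P: "cone G P" and x: "x \<in> carrier G" and D: "D \<subseteq> carrier G"
    and d: "d \<in> semigroup_span G D" "inv d \<in> adjoin G x P"
    and e: "e \<in> semigroup_span G D" "inv e \<in> adjoin G (inv x) P"
  shows "\<exists>g\<in>semigroup_span G D. inv g \<in> P"
proof -
  obtain q n where q: "q \<in> P" "inv d = q \<otimes> x [^] (n::nat)" using d by (auto simp: adjoin_def)
  obtain r m where r: "r \<in> P" "inv e = r \<otimes> inv x [^] (m::nat)" using e by (auto simp: adjoin_def)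
  have c: "q \<in> carrier G" "r \<in> carrier G" using q r cone_carrier[OF P] by auto
  have de: "d \<in> carrier G" "e \<in> carrier G" using d e D semigroup_span_closed by auto
  \<comment> \<open>If an exponent is zero, \<open>d\<close> or \<open>e\<close> itself is the
    witness. The combination is kept for positive exponents, since the span contains no empty
    product.\<close>
  consider "n = 0" | "m = 0" | "n \<ge> 1" "m \<ge> 1" by linarith
  then show ?thesis
  proof cases
    case 1 then show ?thesis using d q c by auto
  next
    case 2 then show ?thesis using e r c by auto
  next
    case 3
    have "d [^] m \<otimes> e [^] n \<in> semigroup_span G D"
      using 3 d e de by (intro semigroup_span.mult pow_in_semigroup_span) auto
    moreover have "inv (d [^] m \<otimes> e [^] n) \<in> P"
    proof -
      have "inv (d [^] m \<otimes> e [^] n) = inv d [^] m \<otimes> inv e [^] n"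
        using de by (simp add: inv_mult nat_pow_inv)
      also have "\<dots> = (q [^] m \<otimes> r [^] n) \<otimes> (x [^] (n * m) \<otimes> inv x [^] (n * m))"
        using q r c x by (simp add: nat_pow_distrib nat_pow_pow m_ac mult.commute)
      also have "\<dots> = q [^] m \<otimes> r [^] n"
        using c x by (simp add: nat_pow_distrib[symmetric])
      finally show ?thesis
        using q r P by (simp add: cone_mult cone_pow)
    qed
    ultimately show ?thesis by blast
  qed
qed

lemma l_coset_Pfe: "A \<in> Pfe G \<Longrightarrow> x \<in> carrier G \<Longrightarrow> x <# A \<in> Pfe G"
  by (auto simp: Pfe_def l_coset_def)

section \<open>Systems of ideals given by cones, and forcing\<close>

text \<open>Each axiom reflects a property of the preorder of \<open>P\<close>: the cut is
  transitivity, that is, closure of \<open>P\<close> under products, and translation holds because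
  \<open>inv a \<otimes> b\<close> does not change when \<open>a\<close> and \<open>b\<close> are
  both multiplied by \<open>x\<close>.\<close>

lemma system_cone_ideals:
  assumes P: "cone G P"
  shows "system_of_ideals G (cone_ideals G P)"
proof -
  have sub: "A \<in> Pfe G \<and> b \<in> carrier G" if "cone_ideals G P A b" for A b
    using that by (auto simp: cone_ideals_def)
  have weaken: "cone_ideals G P (A \<union> A') b" if "cone_ideals G P A b" "A' \<in> Pfe G" for A A' b
    using that by (auto simp: cone_ideals_def Pfe_Un)
  have refl: "cone_ideals G P {a} a" if "a \<in> carrier G" for a
    using that cone_one[OF P] by (auto simp: cone_ideals_def Pfe_def)
  have cut: "cone_ideals G P A b"
    if h: "A \<in> Pfe G" "c \<in> carrier G" "cone_ideals G P A c" "cone_ideals G P (A \<union> {c}) b" for A b c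
  proof -
    have b: "b \<in> carrier G" using h by (auto simp: cone_ideals_def)
    obtain a where a: "a \<in> A" "inv a \<otimes> c \<in> P" using h by (auto simp: cone_ideals_def)
    have ac: "a \<in> carrier G" using Pfe_carrier[OF h(1) a(1)] .
    have "inv a \<otimes> b \<in> P" if "inv c \<otimes> b \<in> P"
      using cone_mult[OF P a(2) that] ac b \<open>c \<in> carrier G\<close> by (simp add: m_assoc)
    then show ?thesis using h a b by (auto simp: cone_ideals_def)
  qed
  have order: "cone_ideals G P {a} b" if "a \<in> carrier G" "b \<in> carrier G" "a \<preceq> b" for a b
    using that P le_iff_one_le[of a b] by (auto simp: cone_ideals_def Pfe_def cone_def)
  have translate: "cone_ideals G P (x <# A) (x \<otimes> b)"
    if h: "x \<in> carrier G" "cone_ideals G P A b" for A b x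
  proof -
    obtain a where a: "a \<in> A" "inv a \<otimes> b \<in> P" "A \<in> Pfe G" "b \<in> carrier G"
      using h by (auto simp: cone_ideals_def)
    have "a \<in> carrier G" using Pfe_carrier[OF a(3,1)] .
    then have "inv (x \<otimes> a) \<otimes> (x \<otimes> b) = inv a \<otimes> b"
      using a h by (simp add: inv_mult_group m_assoc)
    moreover have "x \<otimes> a \<in> x <# A" using a by (auto simp: l_coset_def)
    ultimately have "\<exists>y\<in>x <# A. inv y \<otimes> (x \<otimes> b) \<in> P" using a by force
    then show ?thesis
      using a h by (simp add: cone_ideals_def l_coset_Pfe)
  qed
  show ?thesis
    unfolding system_of_ideals_def
  proof (intro conjI)
    show "\<forall>A\<in>Pfe G. \<forall>b\<in>carrier G. \<forall>c\<in>carrier G.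
        cone_ideals G P A c \<longrightarrow> cone_ideals G P (A \<union> {c}) b \<longrightarrow> cone_ideals G P A b"
      using cut by fast
  qed (simp_all add: sub weaken refl order translate)
qed

lemma rhd_s_eq_cone_ideals: "rhd_s G = cone_ideals G {x \<in> carrier G. \<one> \<preceq> x}"
proof (intro ext)
  fix A b
  have "a \<preceq> b \<longleftrightarrow> inv a \<otimes> b \<in> carrier G \<and> \<one> \<preceq> inv a \<otimes> b" if "A \<in> Pfe G" "a \<in> A" "b \<in> carrier G" for a
    using le_iff_one_le[of a b] Pfe_carrier[OF that(1,2)] that by simp
  then show "rhd_s G A b = cone_ideals G {x \<in> carrier G. \<one> \<preceq> x} A b"
    unfolding rhd_s_def cone_ideals_def mem_Collect_eq by blast
qed

lemma system_rhd_s: "system_of_ideals G (rhd_s G)"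
  using system_cone_ideals[OF cone_positive] by (simp add: rhd_s_eq_cone_ideals)

lemma system_weaken:
  assumes S: "system_of_ideals G S" "S {a} b" and A: "a \<in> A" "A \<in> Pfe G"
  shows "S A b"
  using system_of_idealsD(4)[OF S A(2)] A(1) by (simp add: insert_absorb)

lemma system_trans:
  assumes S: "system_of_ideals G S" and ab: "S {a} b" and bc: "S {b} c"
  shows "S {a} c"
proof -
  have "{a} \<union> {b} \<in> Pfe G"
    using system_of_idealsD(1)[OF S] ab bc by (intro Pfe_Un)
  then have "S ({a} \<union> {b}) c"
    using system_weaken[OF S bc] by simp
  then show ?thesis using system_of_idealsD(5)[OF S ab] by simp
qed

lemma system_translate:
  assumes S: "system_of_ideals G S" and b: "S {\<one>} b" and x: "x \<in> carrier G"
  shows "S {x} (x \<otimes> b)"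
  using system_of_idealsD(7)[OF S b x] x by (simp add: l_coset_def)

text \<open>The order axiom puts \<open>{a}\<close> in relation to \<open>b\<close>, and weakening
  enlarges \<open>{a}\<close> to \<open>A\<close>.\<close>

lemma rhd_s_least:
  assumes S: "system_of_ideals G S"
  shows "rhd_s G \<le> S"
proof (intro le_funI le_boolI)
  fix A b assume "rhd_s G A b"
  then obtain a where a: "A \<in> Pfe G" "b \<in> carrier G" "a \<in> A" "a \<preceq> b"
    by (auto simp: rhd_s_def)
  then have "a \<in> carrier G" using Pfe_carrier by auto
  have "S {a} b" using system_of_idealsD(6)[OF S Pfe_carrier[OF a(1,3)] a(2,4)] .
  then show "S A b" using system_weaken[OF S] a by simp
qed

text \<open>The elements \<open>q\<close> with \<open>S {\<one>} q\<close> are closed under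
  products: translating \<open>S {\<one>} y\<close> by \<open>p\<close> gives
  \<open>S {p} (p \<otimes> y)\<close>, and the cut composes this with
  \<open>S {\<one>} p\<close>.\<close>

lemma system_cone_gen:
  assumes S: "system_of_ideals G S" and ys: "\<forall>y\<in>set ys. S {\<one>} y" and q: "q \<in> cone_gen G ys"
  shows "S {\<one>} q"
  using ys q
proof (induction ys arbitrary: q)
  case Nil
  then show ?case using system_of_idealsD(6)[OF S] by (simp add: cone_gen_def)
next
  case (Cons y ys)
  obtain p n where p: "q = p \<otimes> y [^] (n::nat)" "p \<in> cone_gen G ys"
    using Cons.prems by (auto simp: cone_gen_def adjoin_def)
  have y: "S {\<one>} y" "y \<in> carrier G" using system_of_idealsD(2)[OF S] Cons.prems by auto
  have "S {\<one>} p" using Cons p by simp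
  then have pc: "p \<in> carrier G" using system_of_idealsD(2)[OF S] by simp
  have "S {\<one>} (p \<otimes> y [^] n)"
  proof (induction n)
    case 0
    then show ?case using \<open>S {\<one>} p\<close> pc by simp
  next
    case (Suc n)
    show ?case
      using system_trans[OF S Suc system_translate[OF S y(1)]] pc y by (simp add: m_assoc)
  qed
  then show ?case using p by simp
qed

text \<open>Makes the \<open>LEAST\<close> in \<open>forcing\<close> explicit. For minimality, an
  element \<open>inv a \<otimes> b\<close> of the cone satisfies
  \<open>S {\<one>} (inv a \<otimes> b)\<close> by \<open>system_cone_gen\<close>; translation by
  \<open>a\<close> and weakening then give \<open>S A b\<close>.\<close>

lemma forcing_rhd_s:
  assumes ys: "set ys \<subseteq> carrier G"
  shows "forcing G (rhd_s G) ys = cone_ideals G (cone_gen G ys)"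
  unfolding forcing_def
proof (rule Least_equality)
  have "\<forall>y\<in>set ys. cone_ideals G (cone_gen G ys) {\<one>} y"
    using ys set_subset_cone_gen[OF ys] by (auto simp: cone_ideals_def Pfe_def subset_iff)
  moreover have sys: "system_of_ideals G (cone_ideals G (cone_gen G ys))"
    using system_cone_ideals cone_cone_gen[OF ys] by simp
  ultimately show "system_of_ideals G (cone_ideals G (cone_gen G ys)) \<and>
    rhd_s G \<le> cone_ideals G (cone_gen G ys) \<and> (\<forall>y\<in>set ys. cone_ideals G (cone_gen G ys) {\<one>} y)"
    using rhd_s_least[OF sys] by simp
next
  fix S
  assume S: "system_of_ideals G S \<and> rhd_s G \<le> S \<and> (\<forall>y\<in>set ys. S {\<one>} y)"
  show "cone_ideals G (cone_gen G ys) \<le> S"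
  proof (intro le_funI le_boolI)
    fix A b assume "cone_ideals G (cone_gen G ys) A b"
    then obtain a where a: "A \<in> Pfe G" "b \<in> carrier G" "a \<in> A" "inv a \<otimes> b \<in> cone_gen G ys"
      by (auto simp: cone_ideals_def)
    have ac: "a \<in> carrier G" using Pfe_carrier[OF a(1,3)] .
    have "S {\<one>} (inv a \<otimes> b)" by (rule system_cone_gen[OF _ _ a(4)]) (use S in auto)
    then have "S {a} b" using S system_translate[of S _ a] a ac by fastforce
    then show "S A b" using S system_weaken[of S a] a by simp
  qed
qed

section \<open>The regularisation of the finest system\<close>

lemma signs:
  assumes "list_all2 (\<lambda>x y. y = x \<or> y = inv x) xs ys"
  shows "set xs \<subseteq> carrier G \<Longrightarrow> set ys \<subseteq> carrier G" "\<forall>x\<in>set xs. x \<in> set ys \<or> inv x \<in> set ys"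
  using assms by (induction rule: list_all2_induct) auto

text \<open>The head \<open>x\<close> is eliminated for each choice of signs of the tail separately.
  The hypothesis speaks of the span of \<open>D\<close> because a single elimination already
  replaces two elements of \<open>D\<close> by a product of their powers.\<close>

lemma eliminate_signs:
  assumes P: "D \<subseteq> carrier G" "set xs \<subseteq> carrier G"
    and "\<And>ys. list_all2 (\<lambda>x y. y = x \<or> y = inv x) xs ys \<Longrightarrow>
      \<exists>d\<in>semigroup_span G D. inv d \<in> cone_gen G ys"
  shows "\<exists>d\<in>semigroup_span G D. \<one> \<preceq> inv d"
  using assms(2,3)
proof (induction xs)
  case Nil
  then show ?case by (auto simp: cone_gen_def)
next
  case (Cons x xs)
  have x: "x \<in> carrier G" using Cons.prems by simp
  have "\<exists>d\<in>semigroup_span G D. inv d \<in> cone_gen G ys"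
    if ys: "list_all2 (\<lambda>x y. y = x \<or> y = inv x) xs ys" for ys
  proof -
    have "set ys \<subseteq> carrier G" using signs(1)[OF ys] Cons.prems(1) by simp
    then have cone: "cone G (cone_gen G ys)" by (rule cone_cone_gen)
    have step: "\<exists>d\<in>semigroup_span G D. inv d \<in> adjoin G y (cone_gen G ys)"
      if "y = x \<or> y = inv x" for y
      using Cons.prems(2)[of "y # ys"] ys that by (simp add: cone_gen_def)
    obtain d e where "d \<in> semigroup_span G D" "inv d \<in> adjoin G x (cone_gen G ys)"
      "e \<in> semigroup_span G D" "inv e \<in> adjoin G (inv x) (cone_gen G ys)"
      using step[of x] step[of "inv x"] by auto
    then show ?thesis by (rule eliminate[OF cone x \<open>D \<subseteq> carrier G\<close>])
  qed
  then have "\<exists>d\<in>semigroup_span G D. \<one> \<preceq> inv d"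
    by (intro Cons.IH) (use Cons.prems(1) in auto)
  then show ?case .
qed

lemma diff_Pfe: "A \<in> Pfe G \<Longrightarrow> B \<in> Pfe G \<Longrightarrow> A <#> set_inv B \<in> Pfe G"
  by (auto simp: Pfe_def set_mult_def SET_INV_def)

text \<open>From left to right the \<open>x\<close>'s are eliminated one after the other. From right
  to left a suitable list \<open>xs\<close> must be found, and the finite set \<open>A - B\<close>
  itself serves.\<close>

lemma regularisation_rhd_s:
  "regularisation G (rhd_s G) A B \<longleftrightarrow>
    A \<in> Pfe G \<and> B \<in> Pfe G \<and> (\<exists>d\<in>semigroup_span G (A <#> set_inv B). d \<preceq> \<one>)"
proof (cases "A \<in> Pfe G \<and> B \<in> Pfe G")
  case True
  define D where "D = A <#> set_inv B"
  have D: "D \<in> Pfe G" "D \<subseteq> carrier G" "finite D"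
    using True diff_Pfe unfolding D_def by (auto simp: Pfe_def)
  have le: "d \<preceq> \<one> \<longleftrightarrow> \<one> \<preceq> inv d" if "d \<in> semigroup_span G D" for d
    using le_iff_one_le[of d \<one>] semigroup_span_closed[OF D(2) that] by simp
  have "regularisation G (rhd_s G) A B \<longleftrightarrow>
    (\<exists>xs. set xs \<subseteq> carrier G \<and> (\<forall>ys. list_all2 (\<lambda>x y. y = x \<or> y = inv x) xs ys \<longrightarrow>
      (\<exists>d\<in>D. inv d \<in> cone_gen G ys)))" (is "_ \<longleftrightarrow> (\<exists>xs. ?R xs)")
  proof -
    have "forcing G (rhd_s G) ys D \<one> \<longleftrightarrow> (\<exists>d\<in>D. inv d \<in> cone_gen G ys)"
      if "set xs \<subseteq> carrier G" "list_all2 (\<lambda>x y. y = x \<or> y = inv x) xs ys" for xs ys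
      using forcing_rhd_s[OF signs(1)[OF that(2,1)]] D by (auto simp: cone_ideals_def subset_iff)
    then show ?thesis using True unfolding regularisation_def D_def[symmetric] by auto
  qed
  also have "\<dots> \<longleftrightarrow> (\<exists>d\<in>semigroup_span G D. \<one> \<preceq> inv d)"
  proof
    assume "\<exists>xs. ?R xs"
    then obtain xs where "?R xs" by blast
    then show "\<exists>d\<in>semigroup_span G D. \<one> \<preceq> inv d"
      using eliminate_signs[OF D(2)] semigroup_span.base by meson
  next
    assume "\<exists>d\<in>semigroup_span G D. \<one> \<preceq> inv d"
    then obtain d where d: "d \<in> semigroup_span G D" "\<one> \<preceq> inv d" by blast
    \<comment> \<open>With this list, a choice of signs either contains some \<open>inv x\<close>
      with \<open>x\<close> in \<open>D\<close>, which then is the required element of the cone, or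
      it puts all of \<open>D\<close> into the cone.\<close>
    obtain xs where xs: "set xs = D" using D finite_list by blast
    have "\<exists>c\<in>D. inv c \<in> cone_gen G ys" if ys: "list_all2 (\<lambda>x y. y = x \<or> y = inv x) xs ys" for ys
    proof (cases "\<exists>x\<in>D. inv x \<in> set ys")
      case True
      then show ?thesis
        using set_subset_cone_gen signs(1)[OF ys] D xs by blast
    next
      case False
      have Y: "set ys \<subseteq> carrier G" using signs(1)[OF ys] D xs by blast
      have cone: "cone G (cone_gen G ys)" using cone_cone_gen[OF Y] .
      have DY: "D \<subseteq> cone_gen G ys"
        using False signs(2)[OF ys] D xs set_subset_cone_gen[OF Y] by blast
      \<comment> \<open>One factor \<open>c\<close> is split off from \<open>d\<close>; the others
        are in the cone. Since \<open>d \<preceq> \<one>\<close>, also \<open>inv d\<close> is in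
        the cone, and \<open>inv c\<close> is the product of \<open>q\<close> and
        \<open>inv d\<close>.\<close>
      obtain c q where c: "c \<in> D" "q \<in> cone_gen G ys" "d = c \<otimes> q"
      proof -
        have "\<exists>c\<in>D. \<exists>q\<in>cone_gen G ys. d = c \<otimes> q" using d(1)
        proof (induction rule: semigroup_span.induct)
          case (base d)
          then show ?case using cone_one[OF cone] D by force
        next
          case (mult d e)
          then obtain c q where c: "c \<in> D" "q \<in> cone_gen G ys" "d = c \<otimes> q" by blast
          have e: "e \<in> cone_gen G ys"
            using semigroup_span_subset_cone[OF cone DY mult.hyps(2)] .
          have "d \<otimes> e = c \<otimes> (q \<otimes> e)"
            using c e D cone_carrier[OF cone] by (simp add: m_assoc subset_iff)
          then show ?case using c cone_mult[OF cone c(2) e] by blast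
        qed
        then show ?thesis using that by blast
      qed
      have cc: "c \<in> carrier G" "q \<in> carrier G" using c D cone_carrier[OF cone] by auto
      have "inv d \<in> cone_gen G ys"
        using d semigroup_span_closed[OF D(2) d(1)] cone by (auto simp: cone_def)
      then have "q \<otimes> inv d \<in> cone_gen G ys" using c cone_mult[OF cone] by blast
      also have "q \<otimes> inv d = inv c"
        using c cc by (simp add: inv_mult m_comm[of "inv c"])
      finally show ?thesis using c by blast
    qed
    then show "\<exists>xs. ?R xs" using xs D by blast
  qed
  also have "\<dots> \<longleftrightarrow> (\<exists>d\<in>semigroup_span G D. d \<preceq> \<one>)" using le by blast
  finally show ?thesis using True by (simp add: D_def)
qed (auto simp: regularisation_def)

section \<open>Total cones\<close>

text \<open>Totality forces every element of finite order into \<open>P\<close> together with its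
  inverse, so antisymmetry cannot be demanded.\<close>

definition total_cone :: "'a set \<Rightarrow> bool" where
  "total_cone P \<longleftrightarrow> cone G P \<and> (\<forall>x\<in>carrier G. x \<in> P \<or> inv x \<in> P)"

text \<open>Maximal cones that avoid the inverses of the span are total: if neither \<open>x\<close>
  nor \<open>inv x\<close> could be adjoined, \<open>eliminate\<close> would combine the two
  obstructions into one that is already in \<open>P\<close>. For this the inverses of the whole span
  have to be avoided, and not just those of \<open>D\<close>.\<close>

lemma exists_total_cone:
  assumes D: "D \<subseteq> carrier G" and noneg: "\<not> (\<exists>d\<in>semigroup_span G D. d \<preceq> \<one>)"
  obtains P where "total_cone P" "\<And>d. d \<in> D \<Longrightarrow> inv d \<notin> P"
proof -
  define F where "F = {P. cone G P \<and> (\<forall>d\<in>semigroup_span G D. inv d \<notin> P)}"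
  have "\<not> \<one> \<preceq> inv d" if "d \<in> semigroup_span G D" for d
    using noneg that le_iff_one_le[of d \<one>] semigroup_span_closed[OF D that] by auto
  then have pos: "{x \<in> carrier G. \<one> \<preceq> x} \<in> F"
    using cone_positive by (auto simp: F_def)
  have "\<exists>M\<in>F. \<forall>X\<in>F. M \<subseteq> X \<longrightarrow> X = M"
  proof (rule subset_Zorn_nonempty)
    show "F \<noteq> {}" using pos by blast
  next
    fix C assume C: "C \<noteq> {}" "subset.chain F C"
    have CF: "C \<subseteq> F" using C(2) by (auto simp: subset.chain_def)
    have "x \<otimes> y \<in> \<Union>C" if xy: "x \<in> \<Union>C" "y \<in> \<Union>C" for x y
    proof -
      obtain X Y where XY: "X \<in> C" "Y \<in> C" "x \<in> X" "y \<in> Y" using xy by blast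
      have "X \<subseteq> Y \<or> Y \<subseteq> X" using C(2) XY by (auto simp: subset_chain_def)
      then obtain Z where Z: "Z \<in> C" "x \<in> Z" "y \<in> Z" using XY by blast
      have "cone G Z" using Z CF by (auto simp: F_def)
      then show ?thesis using cone_mult Z by blast
    qed
    moreover have "\<Union>C \<subseteq> carrier G" using CF by (auto simp: F_def cone_def)
    moreover have "{x \<in> carrier G. \<one> \<preceq> x} \<subseteq> \<Union>C"
    proof -
      obtain X where "X \<in> C" using C(1) by blast
      then have "cone G X" using CF by (auto simp: F_def)
      then show ?thesis using \<open>X \<in> C\<close> unfolding cone_def by blast
    qed
    moreover have "\<forall>d\<in>semigroup_span G D. inv d \<notin> \<Union>C" using CF by (auto simp: F_def)
    ultimately show "\<Union>C \<in> F" by (simp add: F_def cone_def)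
  qed
  then obtain P where P: "P \<in> F" and max: "\<And>X. X \<in> F \<Longrightarrow> P \<subseteq> X \<Longrightarrow> X = P" by blast
  have cone: "cone G P" using P by (simp add: F_def)
  have "x \<in> P \<or> inv x \<in> P" if x: "x \<in> carrier G" for x
  proof (rule ccontr)
    assume *: "\<not> (x \<in> P \<or> inv x \<in> P)"
    have "\<exists>d\<in>semigroup_span G D. inv d \<in> adjoin G y P" if y: "y \<in> carrier G" "y \<notin> P" for y
    proof (rule ccontr)
      assume "\<not> ?thesis"
      then have "adjoin G y P \<in> F" using cone_adjoin[OF cone y(1)] by (simp add: F_def)
      then have "adjoin G y P = P" using max subset_adjoin[of P y] cone by (auto simp: cone_def)
      then show False using mem_adjoin[OF cone y(1)] y by simp
    qed
    then obtain d e where "d \<in> semigroup_span G D" "inv d \<in> adjoin G x P"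
      "e \<in> semigroup_span G D" "inv e \<in> adjoin G (inv x) P"
      using * x by (meson inv_closed)
    then show False using eliminate[OF cone x D] P by (auto simp: F_def)
  qed
  then have "total_cone P" using cone by (simp add: total_cone_def)
  moreover have "inv d \<notin> P" if "d \<in> D" for d
    using P semigroup_span.base[OF that] by (auto simp: F_def)
  ultimately show ?thesis using that by blast
qed

end

section \<open>Lattice terms\<close>

lemma gens_Meets [simp]: "gens (Meets a as) = insert a (set as)"
  by (induction a as rule: Meets.induct) auto

lemma gens_Joins [simp]: "gens (Joins a as) = insert a (set as)"
  by (induction a as rule: Joins.induct) auto

lemma lterms_simps [simp]:
  "Gen a \<in> lterms X \<longleftrightarrow> a \<in> X"
  "Meet s t \<in> lterms X \<longleftrightarrow> s \<in> lterms X \<and> t \<in> lterms X"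
  "Join s t \<in> lterms X \<longleftrightarrow> s \<in> lterms X \<and> t \<in> lterms X"
  "Meets a as \<in> lterms X \<longleftrightarrow> a \<in> X \<and> set as \<subseteq> X"
  "Joins a as \<in> lterms X \<longleftrightarrow> a \<in> X \<and> set as \<subseteq> X"
  by (auto simp: lterms_def)

context
  fixes X :: "'a set" and E :: "'a set \<Rightarrow> 'a set \<Rightarrow> bool"
begin

private abbreviation le (infix "\<sqsubseteq>" 50) where "s \<sqsubseteq> t \<equiv> lterm_le X E s t"

lemma lterm_le_lterms: "s \<sqsubseteq> t \<Longrightarrow> s \<in> lterms X \<and> t \<in> lterms X"
  by (induction rule: lterm_le.induct) auto

lemma Meet_coI1: "s \<sqsubseteq> u \<Longrightarrow> t \<in> lterms X \<Longrightarrow> Meet s t \<sqsubseteq> u"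
  using lterm_le.trans lterm_le.meet_left lterm_le_lterms by metis

lemma Meet_coI2: "t \<sqsubseteq> u \<Longrightarrow> s \<in> lterms X \<Longrightarrow> Meet s t \<sqsubseteq> u"
  using lterm_le.trans lterm_le.meet_right lterm_le_lterms by metis

lemma Join_coI1: "s \<sqsubseteq> t \<Longrightarrow> u \<in> lterms X \<Longrightarrow> s \<sqsubseteq> Join t u"
  using lterm_le.trans lterm_le.join_left lterm_le_lterms by metis

lemma Join_coI2: "s \<sqsubseteq> u \<Longrightarrow> t \<in> lterms X \<Longrightarrow> s \<sqsubseteq> Join t u"
  using lterm_le.trans lterm_le.join_right lterm_le_lterms by metis

text \<open>Read backwards, these rules decompose one side and never introduce an intermediate term,
  as in Whitman's procedure for free lattices. This is why \<open>simp\<close> can prove lattice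
  inequalities with them.\<close>

lemmas lattice_rules = lterm_le.refl[of _ X E] lterm_le.meet_greatest[of X E]
  lterm_le.join_least[of X E] Meet_coI1 Meet_coI2 Join_coI1 Join_coI2

text \<open>The calculus has one distributive law as a rule. Its dual results from applying that law
  twice: to the whole meet, and then to the part \<open>Meet (Join s t) u\<close> after commuting
  it.\<close>

lemma dual_distrib:
  assumes "s \<in> lterms X" "t \<in> lterms X" "u \<in> lterms X"
  shows "Meet (Join s t) (Join s u) \<sqsubseteq> Join s (Meet t u)"
proof -
  have 1: "Meet (Join s t) s \<sqsubseteq> Join s (Meet t u)"
    using assms by (simp add: lattice_rules)
  have "Join (Meet u s) (Meet u t) \<sqsubseteq> Join s (Meet t u)"
    using assms by (simp add: lattice_rules)
  then have "Meet u (Join s t) \<sqsubseteq> Join s (Meet t u)"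
    using lterm_le.trans[OF lterm_le.distrib[of u X s t E]] assms by simp
  moreover have "Meet (Join s t) u \<sqsubseteq> Meet u (Join s t)"
    using assms by (simp add: lattice_rules)
  ultimately have 2: "Meet (Join s t) u \<sqsubseteq> Join s (Meet t u)"
    by (rule lterm_le.trans[rotated])
  show ?thesis
    by (rule lterm_le.trans[OF lterm_le.distrib lterm_le.join_least[OF 1 2]]) (use assms in auto)
qed

lemma Meets_append:
  assumes "set (a # as) \<subseteq> X" "set (b # bs) \<subseteq> X"
  shows "Meets a (as @ b # bs) \<sqsubseteq> Meet (Meets a as) (Meets b bs)"
    and "Meet (Meets a as) (Meets b bs) \<sqsubseteq> Meets a (as @ b # bs)"
proof -
  have "Meets a (as @ b # bs) \<sqsubseteq> Meet (Meets a as) (Meets b bs) \<and>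
    Meet (Meets a as) (Meets b bs) \<sqsubseteq> Meets a (as @ b # bs)"
    using assms
  proof (induction as arbitrary: a)
    case Nil
    then show ?case by (auto intro: lterm_le.refl)
  next
    case (Cons c as)
    let ?l = "Meets c (as @ b # bs)" and ?m = "Meets c as" and ?n = "Meets b bs"
    have l: "Gen a \<in> lterms X" "?l \<in> lterms X" "?m \<in> lterms X" "?n \<in> lterms X"
      using Cons.prems by auto
    have IH: "?l \<sqsubseteq> Meet ?m ?n" "Meet ?m ?n \<sqsubseteq> ?l" using Cons by auto
    have 1: "?l \<sqsubseteq> ?m" "?l \<sqsubseteq> ?n"
      using lterm_le.trans[OF IH(1) lterm_le.meet_left] lterm_le.trans[OF IH(1) lterm_le.meet_right] l
      by auto
    have "Meet (Gen a) ?l \<sqsubseteq> Meet (Meet (Gen a) ?m) ?n"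
      by (intro lterm_le.meet_greatest lterm_le.meet_left Meet_coI2 1 l)
    moreover have "Meet (Meet (Gen a) ?m) ?n \<sqsubseteq> Meet (Gen a) ?l"
    proof (rule lterm_le.meet_greatest)
      show "Meet (Meet (Gen a) ?m) ?n \<sqsubseteq> Gen a"
        by (intro Meet_coI1 lterm_le.refl l)
      have "Meet (Meet (Gen a) ?m) ?n \<sqsubseteq> ?m"
        by (rule Meet_coI1, rule Meet_coI2) (auto intro: lterm_le.refl l simp del: lterms_simps)
      moreover have "Meet (Meet (Gen a) ?m) ?n \<sqsubseteq> ?n"
        using l by (intro lterm_le.meet_right) auto
      ultimately show "Meet (Meet (Gen a) ?m) ?n \<sqsubseteq> ?l"
        using lterm_le.trans[OF lterm_le.meet_greatest IH(2)] by blast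
    qed
    ultimately show ?case by simp
  qed
  then show "Meets a (as @ b # bs) \<sqsubseteq> Meet (Meets a as) (Meets b bs)"
    "Meet (Meets a as) (Meets b bs) \<sqsubseteq> Meets a (as @ b # bs)" by auto
qed

lemma Joins_append:
  assumes "set (a # as) \<subseteq> X" "set (b # bs) \<subseteq> X"
  shows "Joins a (as @ b # bs) \<sqsubseteq> Join (Joins a as) (Joins b bs)"
    and "Join (Joins a as) (Joins b bs) \<sqsubseteq> Joins a (as @ b # bs)"
proof -
  have "Joins a (as @ b # bs) \<sqsubseteq> Join (Joins a as) (Joins b bs) \<and>
    Join (Joins a as) (Joins b bs) \<sqsubseteq> Joins a (as @ b # bs)"
    using assms
  proof (induction as arbitrary: a)
    case Nil
    then show ?case by (auto intro: lterm_le.refl)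
  next
    case (Cons c as)
    let ?l = "Joins c (as @ b # bs)" and ?m = "Joins c as" and ?n = "Joins b bs"
    have l: "Gen a \<in> lterms X" "?l \<in> lterms X" "?m \<in> lterms X" "?n \<in> lterms X"
      using Cons.prems by auto
    have IH: "?l \<sqsubseteq> Join ?m ?n" "Join ?m ?n \<sqsubseteq> ?l" using Cons by auto
    have 1: "?m \<sqsubseteq> ?l" "?n \<sqsubseteq> ?l"
      using lterm_le.trans[OF lterm_le.join_left IH(2)] lterm_le.trans[OF lterm_le.join_right IH(2)] l
      by auto
    have "Join (Join (Gen a) ?m) ?n \<sqsubseteq> Join (Gen a) ?l"
      by (intro lterm_le.join_least lterm_le.join_left Join_coI2 1 l)
    moreover have "Join (Gen a) ?l \<sqsubseteq> Join (Join (Gen a) ?m) ?n"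
    proof (rule lterm_le.join_least)
      show "Gen a \<sqsubseteq> Join (Join (Gen a) ?m) ?n"
        by (intro Join_coI1 lterm_le.refl l)
      have "?m \<sqsubseteq> Join (Join (Gen a) ?m) ?n"
        by (rule Join_coI1, rule Join_coI2) (auto intro: lterm_le.refl l simp del: lterms_simps)
      moreover have "?n \<sqsubseteq> Join (Join (Gen a) ?m) ?n"
        using l by (intro lterm_le.join_right) auto
      ultimately show "?l \<sqsubseteq> Join (Join (Gen a) ?m) ?n"
        using lterm_le.trans[OF IH(1) lterm_le.join_least] by blast
    qed
    ultimately show ?case by simp
  qed
  then show "Joins a (as @ b # bs) \<sqsubseteq> Join (Joins a as) (Joins b bs)"
    "Join (Joins a as) (Joins b bs) \<sqsubseteq> Joins a (as @ b # bs)" by auto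
qed

text \<open>
  The context \<open>u\<close> lets distributivity act: this replaces the disjunctive normal form of \<open>s\<close> by the
  choice of one of its disjuncts.
\<close>

lemma Meets_separating:
  assumes "s \<in> lterms X" "u \<in> lterms X" "\<not> Meet u s \<sqsubseteq> t"
  shows "\<exists>a as. set (a # as) \<subseteq> X \<and> Meets a as \<sqsubseteq> s \<and> \<not> Meet u (Meets a as) \<sqsubseteq> t"
  using assms
proof (induction s arbitrary: u)
  case (Gen a)
  then show ?case by (intro exI[of _ a] exI[of _ "[]"]) (auto intro: lterm_le.refl)
next
  case (Join s1 s2)
  have "\<not> Join (Meet u s1) (Meet u s2) \<sqsubseteq> t"
    using Join.prems lterm_le.trans[OF lterm_le.distrib[of u X s1 s2 E]] by auto
  then have "\<not> Meet u s1 \<sqsubseteq> t \<or> \<not> Meet u s2 \<sqsubseteq> t" using lterm_le.join_least by blast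
  then show ?case
  proof
    assume "\<not> Meet u s1 \<sqsubseteq> t"
    then obtain a as where "set (a # as) \<subseteq> X" "Meets a as \<sqsubseteq> s1" "\<not> Meet u (Meets a as) \<sqsubseteq> t"
      using Join.IH(1)[of u] Join.prems by auto
    then show ?thesis using Join_coI1[of "Meets a as" s1 s2] Join.prems by auto
  next
    assume "\<not> Meet u s2 \<sqsubseteq> t"
    then obtain a as where "set (a # as) \<subseteq> X" "Meets a as \<sqsubseteq> s2" "\<not> Meet u (Meets a as) \<sqsubseteq> t"
      using Join.IH(2)[of u] Join.prems by auto
    then show ?thesis using Join_coI2[of "Meets a as" s2 s1] Join.prems by auto
  qed
next
  case (Meet s1 s2)
  note l = Meet.prems(1,2)[simplified] lterm_le.refl[of _ X E]
  \<comment> \<open>First \<open>s1\<close> is moved into the context and a disjunct of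
    \<open>s2\<close> is chosen; then this disjunct is kept in the context while a disjunct of
    \<open>s1\<close> is chosen. The two choices are compatible because the second is made in the
    presence of the first.\<close>
  have "Meet u (Meet s1 s2) \<sqsubseteq> Meet (Meet u s1) s2"
    using l by (simp add: lattice_rules)
  then have "\<not> Meet (Meet u s1) s2 \<sqsubseteq> t" using Meet.prems(3) lterm_le.trans[of X E] by blast
  then obtain b bs where b: "set (b # bs) \<subseteq> X" "Meets b bs \<sqsubseteq> s2"
    "\<not> Meet (Meet u s1) (Meets b bs) \<sqsubseteq> t"
    using Meet.IH(2)[of "Meet u s1"] Meet.prems by auto
  have "Meet (Meet u s1) (Meets b bs) \<sqsubseteq> Meet (Meet u (Meets b bs)) s1"
    using l b by (simp add: lattice_rules)
  then have "\<not> Meet (Meet u (Meets b bs)) s1 \<sqsubseteq> t" using b lterm_le.trans[of X E] by blast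
  then obtain a as where a: "set (a # as) \<subseteq> X" "Meets a as \<sqsubseteq> s1"
    "\<not> Meet (Meet u (Meets b bs)) (Meets a as) \<sqsubseteq> t"
    using Meet.IH(1)[of "Meet u (Meets b bs)"] Meet.prems b by auto
  let ?c = "Meets a (as @ b # bs)"
  have c: "?c \<in> lterms X" "Meets a as \<in> lterms X" "Meets b bs \<in> lterms X" using a b by auto
  note app = Meets_append[OF a(1) b(1)]
  have 1: "?c \<sqsubseteq> Meet s1 s2"
    by (rule lterm_le.trans[OF app(1)]) (use a(2) b(2) c in \<open>simp add: lattice_rules\<close>)
  have "Meet (Meet u (Meets b bs)) (Meets a as) \<sqsubseteq> ?c"
    by (rule lterm_le.trans[OF _ app(2)]) (use c l in \<open>simp add: lattice_rules\<close>)
  then have "Meet (Meet u (Meets b bs)) (Meets a as) \<sqsubseteq> Meet u ?c"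
    using c l by (simp add: lattice_rules)
  then have "\<not> Meet u ?c \<sqsubseteq> t" using a(3) lterm_le.trans[of X E] by blast
  then show ?case using 1 a b by (intro exI[of _ a] exI[of _ "as @ b # bs"]) auto
qed

text \<open>The order dual of \<open>Meets_separating\<close>: the context stands on the right, and
  a conjunct of the conjunctive normal form of \<open>t\<close> is chosen, with
  \<open>dual_distrib\<close> in place of the distributive law.\<close>

lemma Joins_separating:
  assumes "t \<in> lterms X" "u \<in> lterms X" "\<not> s \<sqsubseteq> Join u t"
  shows "\<exists>b bs. set (b # bs) \<subseteq> X \<and> t \<sqsubseteq> Joins b bs \<and> \<not> s \<sqsubseteq> Join u (Joins b bs)"
  using assms
proof (induction t arbitrary: u)
  case (Gen a)
  then show ?case by (intro exI[of _ a] exI[of _ "[]"]) (auto intro: lterm_le.refl)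
next
  case (Meet s1 s2)
  have "\<not> s \<sqsubseteq> Meet (Join u s1) (Join u s2)"
    using Meet.prems lterm_le.trans[OF _ dual_distrib[of u s1 s2]] by auto
  then have "\<not> s \<sqsubseteq> Join u s1 \<or> \<not> s \<sqsubseteq> Join u s2" using lterm_le.meet_greatest by blast
  then show ?case
  proof
    assume "\<not> s \<sqsubseteq> Join u s1"
    then obtain a as where "set (a # as) \<subseteq> X" "s1 \<sqsubseteq> Joins a as" "\<not> s \<sqsubseteq> Join u (Joins a as)"
      using Meet.IH(1)[of u] Meet.prems by auto
    then show ?thesis using Meet_coI1[of s1 "Joins a as" s2] Meet.prems by auto
  next
    assume "\<not> s \<sqsubseteq> Join u s2"
    then obtain a as where "set (a # as) \<subseteq> X" "s2 \<sqsubseteq> Joins a as" "\<not> s \<sqsubseteq> Join u (Joins a as)"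
      using Meet.IH(2)[of u] Meet.prems by auto
    then show ?thesis using Meet_coI2[of s2 "Joins a as" s1] Meet.prems by auto
  qed
next
  case (Join s1 s2)
  note l = Join.prems(1,2)[simplified] lterm_le.refl[of _ X E]
  have "Join (Join u s1) s2 \<sqsubseteq> Join u (Join s1 s2)"
    using l by (simp add: lattice_rules)
  then have "\<not> s \<sqsubseteq> Join (Join u s1) s2" using Join.prems lterm_le.trans[of X E] by blast
  then obtain b bs where b: "set (b # bs) \<subseteq> X" "s2 \<sqsubseteq> Joins b bs"
    "\<not> s \<sqsubseteq> Join (Join u s1) (Joins b bs)"
    using Join.IH(2)[of "Join u s1"] Join.prems by auto
  have "Join (Join u (Joins b bs)) s1 \<sqsubseteq> Join (Join u s1) (Joins b bs)"
    using l b by (simp add: lattice_rules)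
  then have "\<not> s \<sqsubseteq> Join (Join u (Joins b bs)) s1" using b lterm_le.trans[of X E] by blast
  then obtain a as where a: "set (a # as) \<subseteq> X" "s1 \<sqsubseteq> Joins a as"
    "\<not> s \<sqsubseteq> Join (Join u (Joins b bs)) (Joins a as)"
    using Join.IH(1)[of "Join u (Joins b bs)"] Join.prems b by auto
  let ?c = "Joins a (as @ b # bs)"
  have c: "?c \<in> lterms X" "Joins a as \<in> lterms X" "Joins b bs \<in> lterms X" using a b by auto
  note app = Joins_append[OF a(1) b(1)]
  have 1: "Join s1 s2 \<sqsubseteq> ?c"
    by (rule lterm_le.trans[OF _ app(2)]) (use a(2) b(2) c in \<open>simp add: lattice_rules\<close>)
  have "?c \<sqsubseteq> Join (Join u (Joins b bs)) (Joins a as)"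
    by (rule lterm_le.trans[OF app(1)]) (use c l in \<open>simp add: lattice_rules\<close>)
  then have "Join u ?c \<sqsubseteq> Join (Join u (Joins b bs)) (Joins a as)"
    using c l by (simp add: lattice_rules)
  then have "\<not> s \<sqsubseteq> Join u ?c" using a(3) lterm_le.trans[of X E] by blast
  then show ?case using 1 a b by (intro exI[of _ a] exI[of _ "as @ b # bs"]) auto
qed

text \<open>An underivable inequality is traced back to a pair of finite sets not related by
  \<open>E\<close>: the failure passes to a meet of generators below \<open>s\<close> and a join of
  generators above \<open>t\<close>, and the rule \<open>relation\<close> would derive their
  inequality if \<open>E\<close> held.\<close>

lemma separating_relation:
  assumes "s \<in> lterms X" "t \<in> lterms X" "\<not> s \<sqsubseteq> t"
  obtains a as b bs where "set (a # as) \<subseteq> X" "set (b # bs) \<subseteq> X" "Meets a as \<sqsubseteq> s"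
    "t \<sqsubseteq> Joins b bs" "\<not> E (set (a # as)) (set (b # bs))"
proof -
  \<comment> \<open>Terms have no top or bottom to serve as an empty context; \<open>s\<close> and
    \<open>t\<close> take that role by idempotence.\<close>
  have "s \<sqsubseteq> Meet s s" "Join t t \<sqsubseteq> t"
    using assms by (auto intro: lterm_le.meet_greatest lterm_le.join_least lterm_le.refl)
  then have "\<not> Meet s s \<sqsubseteq> t" using assms lterm_le.trans[of X E] by blast
  then obtain a as where a: "set (a # as) \<subseteq> X" "Meets a as \<sqsubseteq> s" "\<not> Meet s (Meets a as) \<sqsubseteq> t"
    using Meets_separating assms by blast
  then have "\<not> Meets a as \<sqsubseteq> t" using Meet_coI2 assms by blast
  then have "\<not> Meets a as \<sqsubseteq> Join t t" using \<open>Join t t \<sqsubseteq> t\<close> lterm_le.trans[of X E] by blast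
  then obtain b bs where b: "set (b # bs) \<subseteq> X" "t \<sqsubseteq> Joins b bs"
    "\<not> Meets a as \<sqsubseteq> Join t (Joins b bs)"
    using Joins_separating assms by blast
  then have "\<not> Meets a as \<sqsubseteq> Joins b bs" using Join_coI2 assms by blast
  then have "\<not> E (set (a # as)) (set (b # bs))" using lterm_le.relation[OF a(1) b(1), of E] by blast
  then show ?thesis using that[OF a(1) b(1) a(2) b(2)] by blast
qed

end

section \<open>Evaluating terms in a total cone\<close>

text \<open>Minimum and maximum for the preorder of \<open>P\<close>, which determines them up to
  equivalence only. The value is always one of the generators. On ties both operations return the
  first argument; this makes \<open>teval_tinv\<close> an equality in \<open>G\<close>.\<close>

fun teval :: "'a ogroup \<Rightarrow> 'a set \<Rightarrow> 'a lterm \<Rightarrow> 'a" where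
  "teval G P (Gen a) = a"
| "teval G P (Meet s t) =
     (if inv\<^bsub>G\<^esub> (teval G P s) \<otimes>\<^bsub>G\<^esub> teval G P t \<in> P then teval G P s else teval G P t)"
| "teval G P (Join s t) =
     (if inv\<^bsub>G\<^esub> (teval G P t) \<otimes>\<^bsub>G\<^esub> teval G P s \<in> P then teval G P s else teval G P t)"

text \<open>Expands the left factor and then the right one, as a product that distributes over meet
  and join must do. In \<open>tinv\<close> the operations are exchanged because inversion reverses
  the order.\<close>

fun tmult :: "'a ogroup \<Rightarrow> 'a lterm \<Rightarrow> 'a lterm \<Rightarrow> 'a lterm" where
  "tmult G (Gen a) t = map_lterm (\<lambda>b. a \<otimes>\<^bsub>G\<^esub> b) t"
| "tmult G (Meet s s') t = Meet (tmult G s t) (tmult G s' t)"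
| "tmult G (Join s s') t = Join (tmult G s t) (tmult G s' t)"

fun tinv :: "'a ogroup \<Rightarrow> 'a lterm \<Rightarrow> 'a lterm" where
  "tinv G (Gen a) = Gen (inv\<^bsub>G\<^esub> a)"
| "tinv G (Meet s t) = Join (tinv G s) (tinv G t)"
| "tinv G (Join s t) = Meet (tinv G s) (tinv G t)"

context ordered_group
begin

definition cle :: "'a set \<Rightarrow> 'a \<Rightarrow> 'a \<Rightarrow> bool" where
  "cle P x y \<longleftrightarrow> inv x \<otimes> y \<in> P"

lemma teval_in_gens: "teval G P s \<in> gens s"
  by (induction s) auto

lemma teval_closed [simp]: "s \<in> lterms (carrier G) \<Longrightarrow> teval G P s \<in> carrier G"
  using teval_in_gens[of P s] by (auto simp: lterms_def)

lemma tmult_lterms [simp]: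
  assumes "s \<in> lterms (carrier G)" "t \<in> lterms (carrier G)"
  shows "tmult G s t \<in> lterms (carrier G)"
proof -
  have "map_lterm (\<lambda>b. a \<otimes> b) t \<in> lterms (carrier G)" if "a \<in> carrier G" for a
    using assms(2) that by (induction t) auto
  then show ?thesis using assms(1) by (induction s) auto
qed

lemma tinv_lterms [simp]: "s \<in> lterms (carrier G) \<Longrightarrow> tinv G s \<in> lterms (carrier G)"
  by (induction s) auto

context
  fixes P assumes P: "total_cone P"
begin

lemma cone_of_total_cone: "cone G P"
  using P by (simp add: total_cone_def)

lemma cle_trans:
  assumes "cle P x y" "cle P y z" "x \<in> carrier G" "y \<in> carrier G" "z \<in> carrier G"
  shows "cle P x z"
  using cone_mult[OF cone_of_total_cone, of "inv x \<otimes> y" "inv y \<otimes> z"] assms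
  by (simp add: cle_def m_assoc)

lemma cle_of_le: "x \<preceq> y \<Longrightarrow> x \<in> carrier G \<Longrightarrow> y \<in> carrier G \<Longrightarrow> cle P x y"
  using cone_of_total_cone le_iff_one_le[of x y] by (auto simp: cle_def cone_def)

lemma cle_refl: "x \<in> carrier G \<Longrightarrow> cle P x x"
  by (simp add: cle_of_le le_refl)

lemma cle_total: "x \<in> carrier G \<Longrightarrow> y \<in> carrier G \<Longrightarrow> cle P x y \<or> cle P y x"
proof -
  assume c: "x \<in> carrier G" "y \<in> carrier G"
  then have "inv (inv x \<otimes> y) = inv y \<otimes> x" by (simp add: inv_mult_group)
  then show ?thesis using P c unfolding total_cone_def cle_def by (metis inv_closed m_closed)
qed

lemma cle_mult_iff:
  assumes "x \<in> carrier G" "y \<in> carrier G" "z \<in> carrier G"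
  shows "cle P (z \<otimes> x) (z \<otimes> y) \<longleftrightarrow> cle P x y"
  using assms by (simp add: cle_def inv_mult_group m_assoc)

lemma cle_mult_right_iff:
  assumes "x \<in> carrier G" "y \<in> carrier G" "z \<in> carrier G"
  shows "cle P (x \<otimes> z) (y \<otimes> z) \<longleftrightarrow> cle P x y"
  using cle_mult_iff[OF assms] assms by (simp add: m_comm)

lemma cle_teval_Meet:
  assumes "z \<in> carrier G" "s \<in> lterms (carrier G)" "t \<in> lterms (carrier G)"
  shows "cle P z (teval G P (Meet s t)) \<longleftrightarrow> cle P z (teval G P s) \<and> cle P z (teval G P t)"
  using assms cle_total[of "teval G P s" "teval G P t"]
    cle_trans[of z "teval G P s" "teval G P t"] cle_trans[of z "teval G P t" "teval G P s"]
  by (auto simp: cle_def[symmetric])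

lemma teval_Join_cle:
  assumes "z \<in> carrier G" "s \<in> lterms (carrier G)" "t \<in> lterms (carrier G)"
  shows "cle P (teval G P (Join s t)) z \<longleftrightarrow> cle P (teval G P s) z \<and> cle P (teval G P t) z"
  using assms cle_total[of "teval G P s" "teval G P t"]
    cle_trans[of "teval G P s" "teval G P t" z] cle_trans[of "teval G P t" "teval G P s" z]
  by (auto simp: cle_def[symmetric])

text \<open>The disjunction is special to totally preordered values, where a minimum is one of its
  arguments. The dual \<open>cle_teval_Join\<close> is what validates the distributive law in
  \<open>teval_sound\<close>.\<close>

lemma teval_Meet_cle:
  assumes "z \<in> carrier G" "s \<in> lterms (carrier G)" "t \<in> lterms (carrier G)"
  shows "cle P (teval G P (Meet s t)) z \<longleftrightarrow> cle P (teval G P s) z \<or> cle P (teval G P t) z"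
  using assms cle_total[of "teval G P s" "teval G P t"]
    cle_trans[of "teval G P s" "teval G P t" z] cle_trans[of "teval G P t" "teval G P s" z]
  by (auto simp: cle_def[symmetric])

lemma cle_teval_Join:
  assumes "z \<in> carrier G" "s \<in> lterms (carrier G)" "t \<in> lterms (carrier G)"
  shows "cle P z (teval G P (Join s t)) \<longleftrightarrow> cle P z (teval G P s) \<or> cle P z (teval G P t)"
  using assms cle_total[of "teval G P s" "teval G P t"]
    cle_trans[of z "teval G P s" "teval G P t"] cle_trans[of z "teval G P t" "teval G P s"]
  by (auto simp: cle_def[symmetric])

lemma teval_Meets_le:
  "set (a # as) \<subseteq> carrier G \<Longrightarrow> x \<in> set (a # as) \<Longrightarrow> cle P (teval G P (Meets a as)) x"
proof (induction as arbitrary: a)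
  case (Cons b bs)
  have "x = a \<or> x \<in> set (b # bs)" "x \<in> carrier G" using Cons.prems by auto
  then show ?case
    using Cons.IH[of b] Cons.prems teval_Meet_cle[of x "Gen a" "Meets b bs"] cle_refl[of x] by auto
qed (auto simp: cle_refl)

lemma teval_Joins_ge:
  "set (a # as) \<subseteq> carrier G \<Longrightarrow> x \<in> set (a # as) \<Longrightarrow> cle P x (teval G P (Joins a as))"
proof (induction as arbitrary: a)
  case (Cons b bs)
  have "x = a \<or> x \<in> set (b # bs)" "x \<in> carrier G" using Cons.prems by auto
  then show ?case
    using Cons.IH[of b] Cons.prems cle_teval_Join[of x "Gen a" "Joins b bs"] cle_refl[of x] by auto
qed (auto simp: cle_refl)

text \<open>By totality, \<open>inv d \<notin> P\<close> says that \<open>d\<close> is strictly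
  positive. A product of strictly positive elements is so too: if \<open>P\<close> contained
  \<open>d\<close> and the inverse of \<open>d \<otimes> e\<close>, it would contain
  \<open>inv e\<close>.\<close>

lemma semigroup_span_positive:
  assumes D: "D \<subseteq> carrier G" "\<And>d. d \<in> D \<Longrightarrow> inv d \<notin> P" and d: "d \<in> semigroup_span G D"
  shows "inv d \<notin> P"
  using d
proof (induction rule: semigroup_span.induct)
  case (mult d e)
  have c: "d \<in> carrier G" "e \<in> carrier G" using mult semigroup_span_closed[OF D(1)] by auto
  then have "d \<in> P" using mult P by (auto simp: total_cone_def)
  moreover have "inv (d \<otimes> e) \<otimes> d = inv e" using c by (simp add: inv_mult m_comm[of _ d] m_assoc[symmetric])
  ultimately show ?case using mult cone_mult[OF cone_of_total_cone, of "inv (d \<otimes> e)" d] by auto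
qed (use D in auto)

text \<open>If the minimum of \<open>A\<close> were not below the maximum of \<open>B\<close>, every
  element of \<open>A - B\<close> would be strictly positive for \<open>P\<close>, and so would its
  span, contradicting the element \<open>d \<preceq> \<one>\<close> given by the
  regularisation.\<close>

lemma teval_sound_relation:
  assumes ab: "set (a # as) \<subseteq> carrier G" "set (b # bs) \<subseteq> carrier G"
    and R: "regularisation G (rhd_s G) (set (a # as)) (set (b # bs))"
  shows "cle P (teval G P (Meets a as)) (teval G P (Joins b bs))"
proof (rule ccontr)
  assume *: "\<not> ?thesis"
  let ?D = "set (a # as) <#> set_inv (set (b # bs))"
  have D: "?D \<subseteq> carrier G" using ab by (auto simp: set_mult_def SET_INV_def)
  have c: "teval G P (Meets a as) \<in> carrier G" "teval G P (Joins b bs) \<in> carrier G"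
    using ab by auto
  have "inv d \<notin> P" if d: "d \<in> ?D" for d
  proof
    assume dP: "inv d \<in> P"
    obtain x y where xy: "x \<in> set (a # as)" "y \<in> set (b # bs)" "d = x \<otimes> inv y"
      using d unfolding set_mult_def SET_INV_def by blast
    have xyc: "x \<in> carrier G" "y \<in> carrier G" using xy ab by auto
    have "inv d = inv x \<otimes> y" using xyc xy by (simp add: inv_mult)
    then have "cle P x y" using dP by (simp add: cle_def)
    moreover have "cle P (teval G P (Meets a as)) x" "cle P y (teval G P (Joins b bs))"
      using teval_Meets_le teval_Joins_ge ab xy by blast+
    ultimately show False using * cle_trans xyc c by blast
  qed
  moreover obtain d where d: "d \<in> semigroup_span G ?D" "d \<preceq> \<one>"
    using R unfolding regularisation_rhd_s by blast
  moreover have "inv d \<in> P"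
    using cle_of_le[of d \<one>] d semigroup_span_closed[OF D d(1)] by (simp add: cle_def)
  ultimately show False using semigroup_span_positive[OF D] by blast
qed

lemma teval_sound:
  assumes "lterm_le (carrier G) (regularisation G (rhd_s G)) s t"
  shows "cle P (teval G P s) (teval G P t)"
  using assms
proof (induction rule: lterm_le.induct)
  case (refl s)
  then show ?case by (simp add: cle_refl)
next
  case (trans s t u)
  then show ?case using lterm_le_lterms[OF trans(1)] lterm_le_lterms[OF trans(2)]
    cle_trans[of "teval G P s" "teval G P t" "teval G P u"] by simp
next
  case (meet_left s t)
  then show ?case using teval_Meet_cle[of "teval G P s" s t] by (simp add: cle_refl del: teval.simps)
next
  case (meet_right s t)
  then show ?case using teval_Meet_cle[of "teval G P t" s t] by (simp add: cle_refl del: teval.simps)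
next
  case (meet_greatest u s t)
  then show ?case
    using lterm_le_lterms[OF meet_greatest(1)] lterm_le_lterms[OF meet_greatest(2)]
    by (simp add: cle_teval_Meet del: teval.simps)
next
  case (join_left s t)
  then show ?case using cle_teval_Join[of "teval G P s" s t] by (simp add: cle_refl del: teval.simps)
next
  case (join_right s t)
  then show ?case using cle_teval_Join[of "teval G P t" s t] by (simp add: cle_refl del: teval.simps)
next
  case (join_least s u t)
  then show ?case
    using lterm_le_lterms[OF join_least(1)] lterm_le_lterms[OF join_least(2)]
    by (simp add: teval_Join_cle del: teval.simps)
next
  case (distrib s t u)
  let ?z = "teval G P (Meet s (Join t u))"
  have z: "?z \<in> carrier G" using distrib by (intro teval_closed) auto
  have "cle P ?z (teval G P s)" "cle P ?z (teval G P t) \<or> cle P ?z (teval G P u)"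
    using cle_teval_Meet[of ?z s "Join t u"] cle_teval_Join[of ?z t u] distrib z cle_refl[OF z]
    by (auto simp del: teval.simps)
  then show ?case
    using cle_teval_Join[OF z, of "Meet s t" "Meet s u"] cle_teval_Meet[OF z, of s t]
      cle_teval_Meet[OF z, of s u] distrib by (auto simp del: teval.simps)
next
  case (relation a as b bs)
  then show ?case by (rule teval_sound_relation)
qed

text \<open>Translation changes the outcome of no comparison, so the same generator is selected and
  the equality is exact, not just up to the equivalence of \<open>P\<close>.\<close>

lemma teval_map_mult:
  assumes "a \<in> carrier G" "t \<in> lterms (carrier G)"
  shows "teval G P (map_lterm (\<lambda>b. a \<otimes> b) t) = a \<otimes> teval G P t"
  using assms(2) by (induction t) (use assms(1) in \<open>auto simp: cle_def[symmetric] cle_mult_iff\<close>)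

lemma teval_tmult:
  assumes "s \<in> lterms (carrier G)" "t \<in> lterms (carrier G)"
  shows "teval G P (tmult G s t) = teval G P s \<otimes> teval G P t"
  using assms by (induction s) (auto simp: teval_map_mult cle_def[symmetric] cle_mult_right_iff)

lemma teval_tinv:
  assumes "s \<in> lterms (carrier G)"
  shows "teval G P (tinv G s) = inv (teval G P s)"
proof -
  have "x \<otimes> inv y \<in> P \<longleftrightarrow> cle P y x" if "x \<in> carrier G" "y \<in> carrier G" for x y
    using that by (simp add: cle_def m_comm)
  then show ?thesis using assms by (induction s) (auto simp: cle_def[symmetric])
qed

end

section \<open>Completeness with respect to total cones\<close>

text \<open>Since \<open>teval\<close> returns a generator, validity in \<open>P\<close> provides
  \<open>x\<close> in \<open>A\<close> and \<open>y\<close> in \<open>B\<close> with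
  \<open>cle P x y\<close>. The total cone obtained when the regularisation fails makes
  \<open>x \<otimes> inv y\<close> strictly positive, which excludes this.\<close>

lemma regularisation_of_teval:
  assumes ab: "set (a # as) \<subseteq> carrier G" "set (b # bs) \<subseteq> carrier G"
    and valid: "\<And>P. total_cone P \<Longrightarrow> cle P (teval G P (Meets a as)) (teval G P (Joins b bs))"
  shows "regularisation G (rhd_s G) (set (a # as)) (set (b # bs))"
proof (rule ccontr)
  assume R: "\<not> ?thesis"
  let ?D = "set (a # as) <#> set_inv (set (b # bs))"
  have "set (a # as) \<in> Pfe G" "set (b # bs) \<in> Pfe G"
    using ab unfolding Pfe_def by auto
  then have "\<not> (\<exists>d\<in>semigroup_span G ?D. d \<preceq> \<one>)"
    using R unfolding regularisation_rhd_s by blast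
  moreover have "?D \<subseteq> carrier G" using ab by (auto simp: set_mult_def SET_INV_def)
  ultimately obtain P where P: "total_cone P" "\<And>d. d \<in> ?D \<Longrightarrow> inv d \<notin> P"
    using exists_total_cone by metis
  define x where "x = teval G P (Meets a as)"
  define y where "y = teval G P (Joins b bs)"
  have x: "x \<in> set (a # as)" using teval_in_gens[of P "Meets a as"] by (simp add: x_def)
  have y: "y \<in> set (b # bs)" using teval_in_gens[of P "Joins b bs"] by (simp add: y_def)
  have c: "x \<in> carrier G" "y \<in> carrier G" using x y ab by auto
  have "cle P x y" using valid[OF P(1)] by (simp add: x_def y_def)
  moreover have "x \<otimes> inv y \<in> ?D" using x y unfolding set_mult_def SET_INV_def by blast
  then have "inv (x \<otimes> inv y) \<notin> P" using P(2) by blast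
  ultimately show False using c by (simp add: cle_def inv_mult)
qed

text \<open>An underivable inequality yields, by \<open>separating_relation\<close>, a meet below
  \<open>s\<close> and a join above \<open>t\<close> that are not related. Soundness on both sides
  carries the validity of \<open>s \<le> t\<close> over to them, against
  \<open>regularisation_of_teval\<close>.\<close>

lemma teval_complete:
  assumes st: "s \<in> lterms (carrier G)" "t \<in> lterms (carrier G)"
    and valid: "\<And>P. total_cone P \<Longrightarrow> cle P (teval G P s) (teval G P t)"
  shows "lterm_le (carrier G) (regularisation G (rhd_s G)) s t"
proof (rule ccontr)
  assume "\<not> ?thesis"
  then obtain a as b bs where ab: "set (a # as) \<subseteq> carrier G" "set (b # bs) \<subseteq> carrier G"
    and le: "lterm_le (carrier G) (regularisation G (rhd_s G)) (Meets a as) s"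
      "lterm_le (carrier G) (regularisation G (rhd_s G)) t (Joins b bs)"
    and R: "\<not> regularisation G (rhd_s G) (set (a # as)) (set (b # bs))"
    using separating_relation st by metis
  have "cle P (teval G P (Meets a as)) (teval G P (Joins b bs))" if P: "total_cone P" for P
  proof -
    have "teval G P (Meets a as) \<in> carrier G" "teval G P (Joins b bs) \<in> carrier G"
      using ab by auto
    then show ?thesis
      using teval_sound[OF P le(1)] valid[OF P] teval_sound[OF P le(2)] cle_trans[OF P] st teval_closed
      by meson
  qed
  then show False using regularisation_of_teval ab R by blast
qed

end

section \<open>Interpreting terms in a lattice-ordered group\<close>

fun interp :: "'b ogroup \<Rightarrow> ('a \<Rightarrow> 'b) \<Rightarrow> 'a lterm \<Rightarrow> 'b" where
  "interp L f (Gen a) = f a"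
| "interp L f (Meet s t) = interp L f s \<sqinter>\<^bsub>poset_of L\<^esub> interp L f t"
| "interp L f (Join s t) = interp L f s \<squnion>\<^bsub>poset_of L\<^esub> interp L f t"

lemma ogroup_hom_hom: "f \<in> ogroup_hom G H \<Longrightarrow> f \<in> hom G H"
  by (simp add: ogroup_hom_def)

lemma ogroup_hom_mono:
  "f \<in> ogroup_hom G H \<Longrightarrow> x \<in> carrier G \<Longrightarrow> y \<in> carrier G \<Longrightarrow> x \<preceq>\<^bsub>G\<^esub> y \<Longrightarrow> f x \<preceq>\<^bsub>H\<^esub> f y"
  by (auto simp: ogroup_hom_def isotone_def)

context l_group
begin

lemma interp_closed: "f \<in> X \<rightarrow> carrier G \<Longrightarrow> s \<in> lterms X \<Longrightarrow> interp G f s \<in> carrier G"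
  by (induction s) auto

lemma interp_Meets_le:
  assumes "f \<in> X \<rightarrow> carrier G" "set (a # as) \<subseteq> X" "x \<in> set (a # as)"
  shows "interp G f (Meets a as) \<preceq> f x"
  using assms(2,3)
proof (induction as arbitrary: a)
  case Nil
  then show ?case using assms(1) by (auto intro: le_refl)
next
  case (Cons b bs)
  have c: "f a \<in> carrier G" "f x \<in> carrier G" "interp G f (Meets b bs) \<in> carrier G"
    using Cons.prems funcset_mem[OF assms(1)] by (auto intro!: interp_closed[OF assms(1)])
  have "x = a \<or> x \<in> set (b # bs)" using Cons.prems by auto
  then show ?case
  proof
    assume "x = a"
    then show ?thesis using c meet_left by simp
  next
    assume "x \<in> set (b # bs)"
    then have "interp G f (Meets b bs) \<preceq> f x" using Cons by auto
    then show ?thesis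
      using le_trans[OF meet_right[OF c(1,3)]] c by simp
  qed
qed

lemma le_interp_Joins:
  assumes "f \<in> X \<rightarrow> carrier G" "set (a # as) \<subseteq> X" "x \<in> set (a # as)"
  shows "f x \<preceq> interp G f (Joins a as)"
  using assms(2,3)
proof (induction as arbitrary: a)
  case Nil
  then show ?case using assms(1) by (auto intro: le_refl)
next
  case (Cons b bs)
  have c: "f a \<in> carrier G" "f x \<in> carrier G" "interp G f (Joins b bs) \<in> carrier G"
    using Cons.prems funcset_mem[OF assms(1)] by (auto intro!: interp_closed[OF assms(1)])
  have "x = a \<or> x \<in> set (b # bs)" using Cons.prems by auto
  then show ?case
  proof
    assume "x = a"
    then show ?thesis using c join_left by simp
  next
    assume "x \<in> set (b # bs)"
    then have "f x \<preceq> interp G f (Joins b bs)" using Cons by auto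
    then show ?thesis
      using le_trans[OF _ join_right[OF c(1,3)]] c by simp
  qed
qed

text \<open>With \<open>M\<close> the meet and \<open>J\<close> the join,
  \<open>M \<otimes> inv J\<close> is below the image of every element of \<open>A - B\<close>. A
  product of k factors gives a k-th power of \<open>M \<otimes> inv J\<close> below the image of
  \<open>d\<close>, hence below \<open>\<one>\<close>, and the k-th root can be taken in a
  lattice-ordered group.\<close>

lemma interp_relation:
  assumes K: "ordered_group K" and f: "f \<in> ogroup_hom K G"
    and ab: "set (a # as) \<subseteq> carrier K" "set (b # bs) \<subseteq> carrier K"
    and R: "regularisation K (rhd_s K) (set (a # as)) (set (b # bs))"
  shows "interp G f (Meets a as) \<preceq> interp G f (Joins b bs)"
proof -
  interpret K: ordered_group K by fact
  interpret f: group_hom K G f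
    by unfold_locales (rule ogroup_hom_hom[OF f])
  let ?D = "set (a # as) <#>\<^bsub>K\<^esub> set_inv\<^bsub>K\<^esub> (set (b # bs))"
  have D: "?D \<subseteq> carrier K" using ab by (auto simp: set_mult_def SET_INV_def)
  have fX: "f \<in> carrier K \<rightarrow> carrier G" by auto
  define M where "M = interp G f (Meets a as)"
  define J where "J = interp G f (Joins b bs)"
  have c: "M \<in> carrier G" "J \<in> carrier G"
    using ab interp_closed[OF fX] unfolding M_def J_def by auto
  obtain d where d: "d \<in> semigroup_span K ?D" "d \<preceq>\<^bsub>K\<^esub> \<one>\<^bsub>K\<^esub>"
    using R unfolding K.regularisation_rhd_s by blast
  have "\<exists>k\<ge>1. (M \<otimes> inv J) [^] (k::nat) \<preceq> f d"
    using d(1)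
  proof (induction rule: semigroup_span.induct)
    case (base d)
    then obtain x y where xy: "x \<in> set (a # as)" "y \<in> set (b # bs)" "d = x \<otimes>\<^bsub>K\<^esub> inv\<^bsub>K\<^esub> y"
      unfolding set_mult_def SET_INV_def by blast
    have xyc: "x \<in> carrier K" "y \<in> carrier K" using xy ab by auto
    have "M \<preceq> f x" "f y \<preceq> J"
      using interp_Meets_le[OF fX ab(1) xy(1)] le_interp_Joins[OF fX ab(2) xy(2)]
      by (simp_all add: M_def J_def)
    then have "M \<otimes> f y \<preceq> f x \<otimes> J" using c xyc by (intro mult_le_mult) auto
    then have "inv J \<otimes> (M \<otimes> f y) \<preceq> f x"
      using c xyc by (simp add: inv_mult_le_iff m_comm[of J])
    then have "inv (f y) \<otimes> (inv J \<otimes> (M \<otimes> f y)) \<preceq> inv (f y) \<otimes> f x"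
      using c xyc by (intro mult_mono) auto
    also have "inv J \<otimes> (M \<otimes> f y) = f y \<otimes> (M \<otimes> inv J)"
      using c xyc by (simp add: m_ac)
    also have "inv (f y) \<otimes> (f y \<otimes> (M \<otimes> inv J)) = M \<otimes> inv J"
      using c xyc by simp
    also have "inv (f y) \<otimes> f x = f d"
      using xyc by (simp add: xy m_comm)
    finally have "(M \<otimes> inv J) [^] (1::nat) \<preceq> f d" using c by simp
    then show ?case by blast
  next
    case (mult d e)
    then obtain k l where kl: "k \<ge> 1" "(M \<otimes> inv J) [^] (k::nat) \<preceq> f d"
      "l \<ge> 1" "(M \<otimes> inv J) [^] (l::nat) \<preceq> f e" by blast
    have de: "d \<in> carrier K" "e \<in> carrier K"
      using mult.hyps K.semigroup_span_closed[OF D] by auto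
    have "(M \<otimes> inv J) [^] k \<otimes> (M \<otimes> inv J) [^] l \<preceq> f d \<otimes> f e"
      using kl c de by (intro mult_le_mult) auto
    then have "(M \<otimes> inv J) [^] (k + l) \<preceq> f (d \<otimes>\<^bsub>K\<^esub> e)"
      using c de by (simp add: nat_pow_mult)
    then show ?case using kl by (intro exI[of _ "k + l"]) auto
  qed
  then obtain k :: nat where k: "k \<ge> 1" "(M \<otimes> inv J) [^] k \<preceq> f d" by blast
  have dc: "d \<in> carrier K" using K.semigroup_span_closed[OF D d(1)] .
  have "f d \<preceq> \<one>" using ogroup_hom_mono[OF f dc K.one_closed d(2)] by simp
  then have "(M \<otimes> inv J) [^] k \<preceq> \<one> [^] k" using le_trans[OF k(2)] c dc by simp
  then have "M \<otimes> inv J \<preceq> \<one>"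
    using le_of_pow_le_pow[of "M \<otimes> inv J" \<one> k] k(1) c by simp
  then have "M \<preceq> J"
    using inv_mult_le_iff[of M \<one> J] c by (simp add: m_comm)
  then show ?thesis by (simp add: M_def J_def)
qed

lemma interp_mono:
  assumes K: "ordered_group K" and f: "f \<in> ogroup_hom K G"
    and st: "lterm_le (carrier K) (regularisation K (rhd_s K)) s t"
  shows "interp G f s \<preceq> interp G f t"
  using st
proof (induction rule: lterm_le.induct)
  have fX: "f \<in> carrier K \<rightarrow> carrier G" using ogroup_hom_hom[OF f] by (auto simp: hom_def)
  note closed = interp_closed[OF fX]
  {
    case (refl s)
    then show ?case by (simp add: closed le_refl)
  next
    case (trans s t u)
    then show ?case
      using le_trans[OF trans.IH] closed lterm_le_lterms[OF trans(1)] lterm_le_lterms[OF trans(2)]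
      by simp
  next
    case (meet_left s t)
    then show ?case by (simp add: closed l_group.meet_left[OF l_group_axioms])
  next
    case (meet_right s t)
    then show ?case by (simp add: closed l_group.meet_right[OF l_group_axioms])
  next
    case (meet_greatest u s t)
    then show ?case
      using closed lterm_le_lterms[OF meet_greatest(1)] lterm_le_lterms[OF meet_greatest(2)]
      by (simp add: l_group.meet_greatest[OF l_group_axioms])
  next
    case (join_left s t)
    then show ?case by (simp add: closed l_group.join_left[OF l_group_axioms])
  next
    case (join_right s t)
    then show ?case by (simp add: closed l_group.join_right[OF l_group_axioms])
  next
    case (join_least s u t)
    then show ?case
      using closed lterm_le_lterms[OF join_least(1)] lterm_le_lterms[OF join_least(2)]
      by (simp add: l_group.join_least[OF l_group_axioms])
  next
    case (distrib s t u)
    then show ?case by (simp add: closed distributive)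
  next
    case (relation a as b bs)
    then show ?case by (rule interp_relation[OF K f])
  }
qed

text \<open>Multiplication distributes over meet and join in both arguments. Applied to the
  generators of a Lorenzen group this determines its group law; applied to a morphism out of
  \<open>G\<close> it makes the mediating map multiplicative.\<close>

lemma interp_tmult:
  assumes K: "ordered_group K" and f: "f \<in> hom K G"
    and st: "s \<in> lterms (carrier K)" "t \<in> lterms (carrier K)"
  shows "interp G f (tmult K s t) = interp G f s \<otimes> interp G f t"
proof -
  interpret K: ordered_group K by fact
  have fX: "f \<in> carrier K \<rightarrow> carrier G" using f by (auto simp: hom_def)
  note closed = interp_closed[OF fX]
  have map: "interp G f (map_lterm (\<lambda>b. a \<otimes>\<^bsub>K\<^esub> b) t) = f a \<otimes> interp G f t"
    if "a \<in> carrier K" for a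
    using st(2) that fX
    by (induction t) (auto simp: hom_mult[OF f] mult_meet mult_join closed Pi_iff)
  have right: "(x \<sqinter>\<^bsub>poset_of G\<^esub> y) \<otimes> z = (x \<otimes> z) \<sqinter>\<^bsub>poset_of G\<^esub> (y \<otimes> z)"
    "(x \<squnion>\<^bsub>poset_of G\<^esub> y) \<otimes> z = (x \<otimes> z) \<squnion>\<^bsub>poset_of G\<^esub> (y \<otimes> z)"
    if "x \<in> carrier G" "y \<in> carrier G" "z \<in> carrier G" for x y z
    using mult_meet[of x y z] mult_join[of x y z] that by (simp_all add: m_comm[of _ z])
  show ?thesis
    using st(1) by (induction s) (use st(2) in \<open>auto simp: map right closed\<close>)
qed

end

lemma l_group_hom_interp:
  assumes g: "g \<in> l_group_hom H L" and H: "l_group H" and f: "f \<in> X \<rightarrow> carrier H"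
    and gf: "\<And>x. x \<in> X \<Longrightarrow> g (f x) = f' x" and s: "s \<in> lterms X"
  shows "g (interp H f s) = interp L f' s"
proof -
  have "g (x \<sqinter>\<^bsub>poset_of H\<^esub> y) = g x \<sqinter>\<^bsub>poset_of L\<^esub> g y"
    "g (x \<squnion>\<^bsub>poset_of H\<^esub> y) = g x \<squnion>\<^bsub>poset_of L\<^esub> g y"
    if "x \<in> carrier H" "y \<in> carrier H" for x y
    using g that by (simp_all add: l_group_hom_def)
  then show ?thesis
    using s by (induction s) (simp_all add: l_group.interp_closed[OF H f] gf)
qed

text \<open>Morphisms are defined by operations alone; the order is recovered from the meet, as
  \<open>x \<preceq> y\<close> means that the meet of \<open>x\<close> and \<open>y\<close> is
  \<open>x\<close>.\<close>

lemma l_group_hom_mono: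
  assumes g: "g \<in> l_group_hom H L" and H: "l_group H" and L: "l_group L"
    and xy: "x \<in> carrier H" "y \<in> carrier H" "x \<preceq>\<^bsub>H\<^esub> y"
  shows "g x \<preceq>\<^bsub>L\<^esub> g y"
proof -
  interpret H: l_group H by fact
  interpret L: l_group L by fact
  have gc: "g x \<in> carrier L" "g y \<in> carrier L"
    using g xy by (auto simp: l_group_hom_def hom_def)
  have "x \<sqinter>\<^bsub>poset_of H\<^esub> y = x"
    using xy by (intro H.le_antisym H.meet_left H.meet_greatest H.le_refl H.meet_closed)
  moreover have "g (x \<sqinter>\<^bsub>poset_of H\<^esub> y) = g x \<sqinter>\<^bsub>poset_of L\<^esub> g y"
    using g xy by (auto simp: l_group_hom_def)
  ultimately have "g x = g x \<sqinter>\<^bsub>poset_of L\<^esub> g y" by simp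
  then show ?thesis using L.meet_right[OF gc] by simp
qed

section \<open>The presented lattice\<close>

definition tclass :: "'a set \<Rightarrow> ('a set \<Rightarrow> 'a set \<Rightarrow> bool) \<Rightarrow> 'a lterm \<Rightarrow> 'a lterm set" where
  "tclass X E s = lterm_cong X E `` {s}"

lemma equiv_lterm_cong: "equiv (lterms X) (lterm_cong X E)"
proof (rule equivI)
  show "lterm_cong X E \<subseteq> lterms X \<times> lterms X"
    using lterm_le_lterms[of X E] by (auto simp: lterm_cong_def)
  show "refl_on (lterms X) (lterm_cong X E)"
    by (auto simp: refl_on_def lterm_cong_def intro: lterm_le.refl)
  show "sym (lterm_cong X E)" by (auto simp: sym_def lterm_cong_def)
  show "trans (lterm_cong X E)"
    by (auto simp: trans_def lterm_cong_def intro: lterm_le.trans)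
qed

lemma tclass_self: "s \<in> lterms X \<Longrightarrow> s \<in> tclass X E s"
  unfolding tclass_def by (rule equiv_class_self[OF equiv_lterm_cong])

lemma mem_tclass_iff: "t \<in> tclass X E s \<longleftrightarrow> lterm_le X E s t \<and> lterm_le X E t s"
  by (simp add: tclass_def lterm_cong_def)

lemma tclass_eq_iff:
  assumes "s \<in> lterms X" "t \<in> lterms X"
  shows "tclass X E s = tclass X E t \<longleftrightarrow> lterm_le X E s t \<and> lterm_le X E t s"
  using eq_equiv_class_iff[OF equiv_lterm_cong assms] by (simp add: tclass_def lterm_cong_def)

lemma carrier_presented_lattice: "carrier (presented_lattice X E) = tclass X E ` lterms X"
  by (auto simp: presented_lattice_def quotient_def tclass_def)

lemma presented_lattice_le_iff:
  assumes "s \<in> lterms X" "t \<in> lterms X"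
  shows "tclass X E s \<sqsubseteq>\<^bsub>presented_lattice X E\<^esub> tclass X E t \<longleftrightarrow> lterm_le X E s t"
proof
  assume "tclass X E s \<sqsubseteq>\<^bsub>presented_lattice X E\<^esub> tclass X E t"
  then obtain s' t' where "lterm_le X E s s'" "lterm_le X E s' t'" "lterm_le X E t' t"
    by (auto simp: presented_lattice_def mem_tclass_iff)
  then show "lterm_le X E s t" by (blast intro: lterm_le.trans)
next
  assume "lterm_le X E s t"
  then show "tclass X E s \<sqsubseteq>\<^bsub>presented_lattice X E\<^esub> tclass X E t"
    using tclass_self[OF assms(1)] tclass_self[OF assms(2)] by (auto simp: presented_lattice_def)
qed

lemma partial_order_presented_lattice: "partial_order (presented_lattice X E)"
proof -
  have eq: "(.=\<^bsub>presented_lattice X E\<^esub>) = (=)" by (simp add: presented_lattice_def)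
  show ?thesis
  proof
    fix x assume "x \<in> carrier (presented_lattice X E)"
    then show "x \<sqsubseteq>\<^bsub>presented_lattice X E\<^esub> x"
      by (auto simp: carrier_presented_lattice presented_lattice_le_iff lterm_le.refl)
  next
    fix x y assume "x \<sqsubseteq>\<^bsub>presented_lattice X E\<^esub> y" "y \<sqsubseteq>\<^bsub>presented_lattice X E\<^esub> x"
      "x \<in> carrier (presented_lattice X E)" "y \<in> carrier (presented_lattice X E)"
    moreover from this obtain s t where
      "x = tclass X E s" "y = tclass X E t" "s \<in> lterms X" "t \<in> lterms X"
      by (auto simp: carrier_presented_lattice)
    ultimately show "x .=\<^bsub>presented_lattice X E\<^esub> y"
      by (simp add: eq presented_lattice_le_iff tclass_eq_iff)
  next
    fix x y z assume "x \<sqsubseteq>\<^bsub>presented_lattice X E\<^esub> y" "y \<sqsubseteq>\<^bsub>presented_lattice X E\<^esub> z"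
      "x \<in> carrier (presented_lattice X E)" "y \<in> carrier (presented_lattice X E)"
      "z \<in> carrier (presented_lattice X E)"
    then show "x \<sqsubseteq>\<^bsub>presented_lattice X E\<^esub> z"
      by (auto simp: carrier_presented_lattice presented_lattice_le_iff intro: lterm_le.trans)
  qed (auto simp: eq)
qed

lemma presented_lattice_greatest:
  assumes "s \<in> lterms X" "t \<in> lterms X"
  shows "greatest (presented_lattice X E) (tclass X E (Meet s t))
    (Lower (presented_lattice X E) {tclass X E s, tclass X E t})"
  unfolding greatest_def
proof (intro conjI ballI)
  have c: "Meet s t \<in> lterms X" using assms by simp
  have "tclass X E u \<in> carrier (presented_lattice X E)" if "u \<in> lterms X" for u
    using that by (simp add: carrier_presented_lattice)
  note carr = this[OF assms(1)] this[OF assms(2)] this[OF c]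
  show "Lower (presented_lattice X E) {tclass X E s, tclass X E t} \<subseteq> carrier (presented_lattice X E)"
    by (simp add: Lower_def)
  show "tclass X E (Meet s t) \<in> Lower (presented_lattice X E) {tclass X E s, tclass X E t}"
    using carr presented_lattice_le_iff[OF c assms(1), of E] presented_lattice_le_iff[OF c assms(2), of E]
      lterm_le.meet_left[OF assms, of E] lterm_le.meet_right[OF assms, of E]
    by (auto simp: Lower_def)
  fix x assume "x \<in> Lower (presented_lattice X E) {tclass X E s, tclass X E t}"
  then have x: "x \<in> carrier (presented_lattice X E)" "x \<sqsubseteq>\<^bsub>presented_lattice X E\<^esub> tclass X E s"
    "x \<sqsubseteq>\<^bsub>presented_lattice X E\<^esub> tclass X E t"
    using carr by (simp_all add: Lower_def)
  then obtain u where u: "x = tclass X E u" "u \<in> lterms X"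
    unfolding carrier_presented_lattice by blast
  then have "lterm_le X E u s" "lterm_le X E u t"
    using x presented_lattice_le_iff[OF u(2)] assms by blast+
  then show "x \<sqsubseteq>\<^bsub>presented_lattice X E\<^esub> tclass X E (Meet s t)"
    using u presented_lattice_le_iff[OF u(2) c] lterm_le.meet_greatest by blast
qed

lemma presented_lattice_least:
  assumes "s \<in> lterms X" "t \<in> lterms X"
  shows "least (presented_lattice X E) (tclass X E (Join s t))
    (Upper (presented_lattice X E) {tclass X E s, tclass X E t})"
  unfolding least_def
proof (intro conjI ballI)
  have c: "Join s t \<in> lterms X" using assms by simp
  have "tclass X E u \<in> carrier (presented_lattice X E)" if "u \<in> lterms X" for u
    using that by (simp add: carrier_presented_lattice)
  note carr = this[OF assms(1)] this[OF assms(2)] this[OF c]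
  show "Upper (presented_lattice X E) {tclass X E s, tclass X E t} \<subseteq> carrier (presented_lattice X E)"
    by (simp add: Upper_def)
  show "tclass X E (Join s t) \<in> Upper (presented_lattice X E) {tclass X E s, tclass X E t}"
    using carr presented_lattice_le_iff[OF assms(1) c, of E] presented_lattice_le_iff[OF assms(2) c, of E]
      lterm_le.join_left[OF assms, of E] lterm_le.join_right[OF assms, of E]
    by (auto simp: Upper_def)
  fix x assume "x \<in> Upper (presented_lattice X E) {tclass X E s, tclass X E t}"
  then have x: "x \<in> carrier (presented_lattice X E)" "tclass X E s \<sqsubseteq>\<^bsub>presented_lattice X E\<^esub> x"
    "tclass X E t \<sqsubseteq>\<^bsub>presented_lattice X E\<^esub> x"
    using carr by (simp_all add: Upper_def)
  then obtain u where u: "x = tclass X E u" "u \<in> lterms X"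
    unfolding carrier_presented_lattice by blast
  then have "lterm_le X E s u" "lterm_le X E t u"
    using x presented_lattice_le_iff[OF _ u(2)] assms by blast+
  then show "tclass X E (Join s t) \<sqsubseteq>\<^bsub>presented_lattice X E\<^esub> x"
    using u presented_lattice_le_iff[OF c u(2)] lterm_le.join_least by blast
qed

lemma lattice_presented_lattice: "lattice (presented_lattice X E)"
proof -
  interpret partial_order "presented_lattice X E" by (rule partial_order_presented_lattice)
  show ?thesis
  proof
    fix x y assume "x \<in> carrier (presented_lattice X E)" "y \<in> carrier (presented_lattice X E)"
    then obtain s t where st: "x = tclass X E s" "y = tclass X E t" "s \<in> lterms X" "t \<in> lterms X"
      by (auto simp: carrier_presented_lattice)
    show "\<exists>s. least (presented_lattice X E) s (Upper (presented_lattice X E) {x, y})"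
      unfolding st(1,2) by (rule exI, rule presented_lattice_least[OF st(3,4)])
    show "\<exists>s. greatest (presented_lattice X E) s (Lower (presented_lattice X E) {x, y})"
      unfolding st(1,2) by (rule exI, rule presented_lattice_greatest[OF st(3,4)])
  qed
qed

lemma presented_lattice_meet:
  assumes "s \<in> lterms X" "t \<in> lterms X"
  shows "tclass X E s \<sqinter>\<^bsub>presented_lattice X E\<^esub> tclass X E t = tclass X E (Meet s t)"
proof -
  interpret lattice "presented_lattice X E" by (rule lattice_presented_lattice)
  show ?thesis
    by (rule meetI, erule greatest_unique[OF _ presented_lattice_greatest[OF assms]])
      (use assms in \<open>simp_all add: carrier_presented_lattice\<close>)
qed

lemma presented_lattice_join:
  assumes "s \<in> lterms X" "t \<in> lterms X"
  shows "tclass X E s \<squnion>\<^bsub>presented_lattice X E\<^esub> tclass X E t = tclass X E (Join s t)"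
proof -
  interpret lattice "presented_lattice X E" by (rule lattice_presented_lattice)
  show ?thesis
    by (rule joinI, erule least_unique[OF _ presented_lattice_least[OF assms]])
      (use assms in \<open>simp_all add: carrier_presented_lattice\<close>)
qed

definition some_term :: "'a lterm set \<Rightarrow> 'a lterm" where
  "some_term A = (SOME s. s \<in> A)"

lemma some_term_tclass:
  assumes "s \<in> lterms X"
  shows "lterm_le X E s (some_term (tclass X E s))" "lterm_le X E (some_term (tclass X E s)) s"
    "some_term (tclass X E s) \<in> lterms X"
proof -
  have "some_term (tclass X E s) \<in> tclass X E s"
    unfolding some_term_def using tclass_self[OF assms] by (rule someI)
  then show "lterm_le X E s (some_term (tclass X E s))" "lterm_le X E (some_term (tclass X E s)) s"
    by (simp_all add: mem_tclass_iff)
  then show "some_term (tclass X E s) \<in> lterms X" using lterm_le_lterms[of X E] by blast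
qed

section \<open>The Lorenzen group\<close>

text \<open>The product is taken on representatives chosen by \<open>some_term\<close>; its
  independence of them is \<open>mult_lorenzen_model\<close>, a consequence of
  \<open>tmult_mono\<close>.\<close>

definition lorenzen_model :: "'a ogroup \<Rightarrow> 'a lterm set ogroup" where
  "lorenzen_model G =
     (let c = tclass (carrier G) (regularisation G (rhd_s G)) in
      \<lparr>carrier = c ` lterms (carrier G),
       mult = (\<lambda>A B. c (tmult G (some_term A) (some_term B))),
       one = c (Gen \<one>\<^bsub>G\<^esub>),
       ole = gorder.le (lorenzen_lattice G (rhd_s G))\<rparr>)"

lemma poset_of_lorenzen_model: "poset_of (lorenzen_model G) = lorenzen_lattice G (rhd_s G)"
  by (simp add: poset_of_def lorenzen_model_def Let_def lorenzen_lattice_def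
      carrier_presented_lattice[symmetric]) (simp add: presented_lattice_def)

lemma lorenzen_gen_eq: "lorenzen_gen G R a = tclass (carrier G) (regularisation G R) (Gen a)"
  by (simp add: lorenzen_gen_def tclass_def)

section \<open>The model, and the universal property of every Lorenzen group\<close>

context ordered_group
begin

abbreviation tle :: "'a lterm \<Rightarrow> 'a lterm \<Rightarrow> bool" where
  "tle \<equiv> lterm_le (carrier G) (regularisation G (rhd_s G))"

abbreviation cls :: "'a lterm \<Rightarrow> 'a lterm set" where
  "cls \<equiv> tclass (carrier G) (regularisation G (rhd_s G))"

abbreviation T :: "'a lterm set" where
  "T \<equiv> lterms (carrier G)"

lemma tle_iff:
  assumes "s \<in> T" "t \<in> T"
  shows "tle s t \<longleftrightarrow> (\<forall>P. total_cone P \<longrightarrow> cle P (teval G P s) (teval G P t))"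
  using teval_sound teval_complete assms by blast

text \<open>Reduces the group axioms and the distribution over meet and join to identities in
  \<open>G\<close> between values, one total cone at a time.\<close>

lemma cls_eqI:
  assumes "s \<in> T" "t \<in> T" "\<And>P. total_cone P \<Longrightarrow> teval G P s = teval G P t"
  shows "cls s = cls t"
  using assms cle_refl by (simp add: tclass_eq_iff tle_iff)

text \<open>Argued through values and not by induction on derivations: in each total cone both
  factors can be replaced by translation invariance, and completeness turns the result back into a
  derivation.\<close>

lemma tmult_mono:
  assumes s: "tle s s'" and t: "tle t t'"
  shows "tle (tmult G s t) (tmult G s' t')"
proof -
  have c: "s \<in> T" "s' \<in> T" "t \<in> T" "t' \<in> T"
    using lterm_le_lterms[OF s] lterm_le_lterms[OF t] by auto
  have "cle P (teval G P (tmult G s t)) (teval G P (tmult G s' t'))" if P: "total_cone P" for P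
  proof -
    have "cle P (teval G P s \<otimes> teval G P t) (teval G P s' \<otimes> teval G P t)"
      "cle P (teval G P s' \<otimes> teval G P t) (teval G P s' \<otimes> teval G P t')"
      using teval_sound[OF P s] teval_sound[OF P t] c
      by (simp_all add: cle_mult_iff[OF P] cle_mult_right_iff[OF P])
    then show ?thesis
      using cle_trans[OF P] c by (simp add: teval_tmult[OF P])
  qed
  then show ?thesis using c by (simp add: tle_iff)
qed

lemma carrier_lorenzen_model: "carrier (lorenzen_model G) = cls ` T"
  by (simp add: lorenzen_model_def Let_def)

lemma one_lorenzen_model: "\<one>\<^bsub>lorenzen_model G\<^esub> = cls (Gen \<one>)"
  by (simp add: lorenzen_model_def Let_def)

lemma mult_lorenzen_model:
  assumes "s \<in> T" "t \<in> T"
  shows "cls s \<otimes>\<^bsub>lorenzen_model G\<^esub> cls t = cls (tmult G s t)"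
proof -
  note s = some_term_tclass[OF assms(1), of "regularisation G (rhd_s G)"]
  note t = some_term_tclass[OF assms(2), of "regularisation G (rhd_s G)"]
  have "cls (tmult G (some_term (cls s)) (some_term (cls t))) = cls (tmult G s t)"
    using s t assms by (simp add: tclass_eq_iff tmult_mono)
  then show ?thesis by (simp add: lorenzen_model_def Let_def)
qed

lemma ole_lorenzen_model:
  assumes "s \<in> T" "t \<in> T"
  shows "cls s \<preceq>\<^bsub>lorenzen_model G\<^esub> cls t \<longleftrightarrow> tle s t"
  using presented_lattice_le_iff[OF assms]
  by (simp add: lorenzen_model_def Let_def lorenzen_lattice_def)

lemma lorenzen_lattice_meet_join:
  assumes "s \<in> T" "t \<in> T"
  shows "cls s \<sqinter>\<^bsub>lorenzen_lattice G (rhd_s G)\<^esub> cls t = cls (Meet s t)"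
    and "cls s \<squnion>\<^bsub>lorenzen_lattice G (rhd_s G)\<^esub> cls t = cls (Join s t)"
  using presented_lattice_meet[OF assms] presented_lattice_join[OF assms]
  by (simp_all add: lorenzen_lattice_def)

lemma comm_group_lorenzen_model: "comm_group (lorenzen_model G)"
proof (rule comm_groupI)
  show "x \<otimes>\<^bsub>lorenzen_model G\<^esub> y \<in> carrier (lorenzen_model G)"
    if "x \<in> carrier (lorenzen_model G)" "y \<in> carrier (lorenzen_model G)" for x y
    using that by (auto simp: carrier_lorenzen_model mult_lorenzen_model)
  show "\<one>\<^bsub>lorenzen_model G\<^esub> \<in> carrier (lorenzen_model G)"
    by (simp add: carrier_lorenzen_model one_lorenzen_model)
  show "x \<otimes>\<^bsub>lorenzen_model G\<^esub> y \<otimes>\<^bsub>lorenzen_model G\<^esub> z =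
      x \<otimes>\<^bsub>lorenzen_model G\<^esub> (y \<otimes>\<^bsub>lorenzen_model G\<^esub> z)"
    if xyz: "x \<in> carrier (lorenzen_model G)" "y \<in> carrier (lorenzen_model G)"
      "z \<in> carrier (lorenzen_model G)" for x y z
  proof -
    obtain s t u where st: "x = cls s" "y = cls t" "z = cls u" "s \<in> T" "t \<in> T" "u \<in> T"
      using xyz by (auto simp: carrier_lorenzen_model)
    have "cls (tmult G (tmult G s t) u) = cls (tmult G s (tmult G t u))"
      by (rule cls_eqI) (use st in \<open>simp_all add: teval_tmult m_assoc\<close>)
    then show ?thesis using st by (simp add: mult_lorenzen_model)
  qed
  show "x \<otimes>\<^bsub>lorenzen_model G\<^esub> y = y \<otimes>\<^bsub>lorenzen_model G\<^esub> x"
    if xy: "x \<in> carrier (lorenzen_model G)" "y \<in> carrier (lorenzen_model G)" for x y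
  proof -
    obtain s t where st: "x = cls s" "y = cls t" "s \<in> T" "t \<in> T"
      using xy by (auto simp: carrier_lorenzen_model)
    have "cls (tmult G s t) = cls (tmult G t s)"
      by (rule cls_eqI) (use st in \<open>simp_all add: teval_tmult m_comm\<close>)
    then show ?thesis using st by (simp add: mult_lorenzen_model)
  qed
  show "\<one>\<^bsub>lorenzen_model G\<^esub> \<otimes>\<^bsub>lorenzen_model G\<^esub> x = x"
    if x: "x \<in> carrier (lorenzen_model G)" for x
  proof -
    obtain s where s: "x = cls s" "s \<in> T" using x by (auto simp: carrier_lorenzen_model)
    have "cls (tmult G (Gen \<one>) s) = cls s"
      by (rule cls_eqI) (use s tmult_lterms[of "Gen \<one>" s] in \<open>auto simp: teval_tmult simp del: tmult.simps\<close>)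
    then show ?thesis
      using s by (simp add: mult_lorenzen_model one_lorenzen_model del: tmult.simps)
  qed
  show "\<exists>y\<in>carrier (lorenzen_model G). y \<otimes>\<^bsub>lorenzen_model G\<^esub> x = \<one>\<^bsub>lorenzen_model G\<^esub>"
    if x: "x \<in> carrier (lorenzen_model G)" for x
  proof -
    obtain s where s: "x = cls s" "s \<in> T" using x by (auto simp: carrier_lorenzen_model)
    have "cls (tmult G (tinv G s) s) = cls (Gen \<one>)"
      by (rule cls_eqI) (use s in \<open>auto simp: teval_tmult teval_tinv\<close>)
    then show ?thesis
      using s by (intro bexI[of _ "cls (tinv G s)"])
        (simp_all add: mult_lorenzen_model one_lorenzen_model carrier_lorenzen_model)
  qed
qed

lemma l_group_lorenzen_model: "l_group (lorenzen_model G)"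
proof -
  have L: "lattice (lorenzen_lattice G (rhd_s G))"
    unfolding lorenzen_lattice_def by (rule lattice_presented_lattice)
  show ?thesis
  proof (intro l_group.intro l_group_axioms.intro ordered_group.intro ordered_group_axioms.intro)
    show "comm_group (lorenzen_model G)" by (rule comm_group_lorenzen_model)
    show "partial_order (poset_of (lorenzen_model G))"
      using partial_order_presented_lattice by (simp add: poset_of_lorenzen_model lorenzen_lattice_def)
    show "lattice (poset_of (lorenzen_model G))"
      using L by (simp add: poset_of_lorenzen_model)
  next
    fix x y z assume xyz: "x \<in> carrier (lorenzen_model G)" "y \<in> carrier (lorenzen_model G)"
      "z \<in> carrier (lorenzen_model G)"
    then obtain s t u where st: "x = cls s" "y = cls t" "z = cls u" "s \<in> T" "t \<in> T" "u \<in> T"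
      by (auto simp: carrier_lorenzen_model)
    show "z \<otimes>\<^bsub>lorenzen_model G\<^esub> x \<preceq>\<^bsub>lorenzen_model G\<^esub> z \<otimes>\<^bsub>lorenzen_model G\<^esub> y"
      if "x \<preceq>\<^bsub>lorenzen_model G\<^esub> y"
      using that st by (simp add: ole_lorenzen_model mult_lorenzen_model tmult_mono lterm_le.refl)
    have "cls (tmult G u (Meet s t)) = cls (Meet (tmult G u s) (tmult G u t))"
      "cls (tmult G u (Join s t)) = cls (Join (tmult G u s) (tmult G u t))"
      by (rule cls_eqI; use st in \<open>simp add: teval_tmult cle_def[symmetric] cle_mult_iff\<close>)+
    then show "z \<otimes>\<^bsub>lorenzen_model G\<^esub> (x \<sqinter>\<^bsub>poset_of (lorenzen_model G)\<^esub> y) =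
        (z \<otimes>\<^bsub>lorenzen_model G\<^esub> x) \<sqinter>\<^bsub>poset_of (lorenzen_model G)\<^esub> (z \<otimes>\<^bsub>lorenzen_model G\<^esub> y)"
      "z \<otimes>\<^bsub>lorenzen_model G\<^esub> (x \<squnion>\<^bsub>poset_of (lorenzen_model G)\<^esub> y) =
        (z \<otimes>\<^bsub>lorenzen_model G\<^esub> x) \<squnion>\<^bsub>poset_of (lorenzen_model G)\<^esub> (z \<otimes>\<^bsub>lorenzen_model G\<^esub> y)"
      using st by (simp_all add: poset_of_lorenzen_model lorenzen_lattice_meet_join mult_lorenzen_model)
  qed
qed

lemma lorenzen_group_lorenzen_model: "lorenzen_group G (rhd_s G) (lorenzen_model G)"
proof -
  have "lorenzen_gen G (rhd_s G) \<in> hom G (lorenzen_model G)"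
  proof (rule homI)
    fix x y assume "x \<in> carrier G" "y \<in> carrier G"
    then show "lorenzen_gen G (rhd_s G) (x \<otimes> y) =
        lorenzen_gen G (rhd_s G) x \<otimes>\<^bsub>lorenzen_model G\<^esub> lorenzen_gen G (rhd_s G) y"
      by (simp add: lorenzen_gen_eq mult_lorenzen_model)
  qed (simp add: lorenzen_gen_eq carrier_lorenzen_model)
  then show ?thesis
    by (simp add: lorenzen_group_def l_group_lorenzen_model poset_of_lorenzen_model)
qed

text \<open>
  Only the order of a Lorenzen group is given; its group law is recovered from the fact that terms
  are multiplied by distributing over the lattice operations.
\<close>

context
  fixes L assumes L: "lorenzen_group G (rhd_s G) L"
begin

lemma lorenzen_l_group: "l_group L"
  using L by (simp add: lorenzen_group_def)

lemma lorenzen_poset_of: "poset_of L = presented_lattice (carrier G) (regularisation G (rhd_s G))"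
  using L by (simp add: lorenzen_group_def lorenzen_lattice_def)

lemma lorenzen_carrier: "carrier L = cls ` T"
  using arg_cong[OF lorenzen_poset_of, of carrier] by (simp add: carrier_presented_lattice)

lemma lorenzen_ole:
  assumes "s \<in> T" "t \<in> T"
  shows "cls s \<preceq>\<^bsub>L\<^esub> cls t \<longleftrightarrow> tle s t"
  using arg_cong[OF lorenzen_poset_of, of gorder.le] presented_lattice_le_iff[OF assms] by simp

lemma lorenzen_gen_hom: "lorenzen_gen G (rhd_s G) \<in> hom G L"
  using L by (simp add: lorenzen_group_def)

lemma interp_lorenzen_gen: "s \<in> T \<Longrightarrow> interp L (lorenzen_gen G (rhd_s G)) s = cls s"
  by (induction s)
    (simp_all add: lorenzen_gen_eq lorenzen_poset_of presented_lattice_meet presented_lattice_join)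

lemma lorenzen_mult:
  assumes "s \<in> T" "t \<in> T"
  shows "cls s \<otimes>\<^bsub>L\<^esub> cls t = cls (tmult G s t)"
  using l_group.interp_tmult[OF lorenzen_l_group ordered_group_axioms lorenzen_gen_hom assms] assms
  by (simp add: interp_lorenzen_gen)

lemma lorenzen_gen_ogroup_hom: "lorenzen_gen G (rhd_s G) \<in> ogroup_hom G L"
proof -
  interpret L: l_group L by (rule lorenzen_l_group)
  have "tle (Gen x) (Gen y)" if "x \<in> carrier G" "y \<in> carrier G" "x \<preceq> y" for x y
    using that by (simp add: tle_iff cle_of_le)
  then have "isotone (poset_of G) (poset_of L) (lorenzen_gen G (rhd_s G))"
    using partial_order.axioms(1)[OF partial_order] partial_order.axioms(1)[OF L.partial_order]
    by (intro isotoneI) (simp_all add: lorenzen_gen_eq lorenzen_ole)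
  then show ?thesis using lorenzen_gen_hom by (simp add: ogroup_hom_def)
qed

text \<open>The mediating morphism interprets a representative of each class;
  \<open>interp_mono\<close> makes the result independent of the representative. It is unique
  because every element is the class of a term, hence a lattice combination of generators. The type
  \<open>'u\<close> is arbitrary, so every instance of the universal property is available.\<close>

lemma lorenzen_freely_generated:
  "freely_generated TYPE('u) G L (lorenzen_gen G (rhd_s G))"
  unfolding freely_generated_def
proof (intro conjI allI impI)
  show "l_group L" by (rule lorenzen_l_group)
  show "lorenzen_gen G (rhd_s G) \<in> ogroup_hom G L" by (rule lorenzen_gen_ogroup_hom)
next
  fix K :: "'u ogroup" and f assume K: "l_group K" and f: "f \<in> ogroup_hom G K"
  interpret K: l_group K by fact
  have fX: "f \<in> carrier G \<rightarrow> carrier K" using ogroup_hom_hom[OF f] by (auto simp: hom_def)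
  note closed = K.interp_closed[OF fX]
  define g where "g = restrict (\<lambda>A. interp K f (some_term A)) (carrier L)"
  have g: "g (cls s) = interp K f s" if s: "s \<in> T" for s
  proof -
    note t = some_term_tclass[OF s, of "regularisation G (rhd_s G)"]
    have "interp K f (some_term (cls s)) = interp K f s"
      using t s closed K.interp_mono[OF ordered_group_axioms f] by (intro K.le_antisym) auto
    then show ?thesis using s by (simp add: g_def lorenzen_carrier)
  qed
  show "\<exists>!g. g \<in> l_group_hom L K \<and> g \<in> extensional (carrier L) \<and>
    (\<forall>x\<in>carrier G. g (lorenzen_gen G (rhd_s G) x) = f x)"
  proof (intro ex1I[of _ g] conjI ballI)
    show "g \<in> extensional (carrier L)" by (simp add: g_def)
    show "g (lorenzen_gen G (rhd_s G) x) = f x" if "x \<in> carrier G" for x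
      using g[of "Gen x"] that by (simp add: lorenzen_gen_eq)
    have "g \<in> hom L K"
      by (rule homI)
        (auto simp: lorenzen_carrier lorenzen_mult g closed
          K.interp_tmult[OF ordered_group_axioms ogroup_hom_hom[OF f]])
    then show "g \<in> l_group_hom L K"
      by (auto simp: l_group_hom_def lorenzen_carrier lorenzen_poset_of g
          presented_lattice_meet presented_lattice_join)
  next
    fix h assume h: "h \<in> l_group_hom L K \<and> h \<in> extensional (carrier L) \<and>
      (\<forall>x\<in>carrier G. h (lorenzen_gen G (rhd_s G) x) = f x)"
    have gen: "lorenzen_gen G (rhd_s G) \<in> carrier G \<rightarrow> carrier L"
      using lorenzen_gen_hom by (auto simp: hom_def)
    have "h (cls s) = interp K f s" if s: "s \<in> T" for s
      using l_group_hom_interp[of h L K _ "carrier G" f, OF _ lorenzen_l_group gen _ s] h s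
      by (simp add: interp_lorenzen_gen)
    then show "h = g"
      using h g by (intro extensionalityI[of _ "carrier L"]) (auto simp: lorenzen_carrier g_def)
  qed
qed

end

section \<open>Exponents of the products of differences\<close>

text \<open>The exponents count how often each index is used. A factor contributes one
  \<open>a i\<close> and one \<open>inv (b j)\<close>, so both sums equal the number of factors,
  which is at least 1. Counting indices instead of elements allows repetitions in the
  families.\<close>

lemma semigroup_span_diff:
  assumes a: "a \<in> {..<k::nat} \<rightarrow> carrier G" and b: "b \<in> {..<l::nat} \<rightarrow> carrier G"
    and d: "d \<in> semigroup_span G (a ` {..<k} <#> set_inv (b ` {..<l}))"
  shows "\<exists>(n :: nat \<Rightarrow> nat) (m :: nat \<Rightarrow> nat).
    (\<Sum>i<k. n i) = (\<Sum>j<l. m j) \<and> (\<Sum>j<l. m j) \<ge> 1 \<and>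
    d \<otimes> (\<Otimes>j\<in>{..<l}. b j [^] m j) = (\<Otimes>i\<in>{..<k}. a i [^] n i)"
  using d
proof (induction rule: semigroup_span.induct)
  case (base d)
  then obtain i j where ij: "i < k" "j < l" "d = a i \<otimes> inv (b j)"
    unfolding set_mult_def SET_INV_def by blast
  have c: "a i \<in> carrier G" "b j \<in> carrier G" using a b ij by auto
  have power: "(\<Otimes>i'\<in>{..<p}. c i' [^] (if i' = q then 1 else 0 :: nat)) = c q"
    if "q < p" "c \<in> {..<p} \<rightarrow> carrier G" for c and p q :: nat
  proof -
    have "(\<Otimes>i'\<in>{..<p}. c i' [^] (if i' = q then 1 else 0 :: nat)) =
        (\<Otimes>i'\<in>{..<p}. if i' = q then c i' else \<one>)"
      using that by (intro finprod_cong') (auto simp: Pi_iff)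
    then show ?thesis using finprod_singleton_swap[of q "{..<p}" c] that by simp
  qed
  show ?case
    by (rule exI[of _ "\<lambda>i'. if i' = i then 1 else 0"], rule exI[of _ "\<lambda>j'. if j' = j then 1 else 0"])
      (use ij c power[OF ij(1) a] power[OF ij(2) b] in \<open>simp add: m_assoc\<close>)
next
  case (mult d e)
  obtain n m where d: "(\<Sum>i<k. n i) = (\<Sum>j<l. m j :: nat)" "(\<Sum>j<l. m j) \<ge> 1"
    "d \<otimes> (\<Otimes>j\<in>{..<l}. b j [^] m j) = (\<Otimes>i\<in>{..<k}. a i [^] n i)"
    using mult.IH(1) by blast
  obtain n' m' where e: "(\<Sum>i<k. n' i) = (\<Sum>j<l. m' j :: nat)" "(\<Sum>j<l. m' j) \<ge> 1"
    "e \<otimes> (\<Otimes>j\<in>{..<l}. b j [^] m' j) = (\<Otimes>i\<in>{..<k}. a i [^] n' i)"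
    using mult.IH(2) by blast
  have "a ` {..<k} <#> set_inv (b ` {..<l}) \<subseteq> carrier G"
    using a b by (auto simp: set_mult_def SET_INV_def)
  then have c: "d \<in> carrier G" "e \<in> carrier G"
    using mult.hyps semigroup_span_closed by auto
  have split: "(\<Otimes>i\<in>{..<p}. c i [^] (u i + v i)) = (\<Otimes>i\<in>{..<p}. c i [^] u i) \<otimes> (\<Otimes>i\<in>{..<p}. c i [^] v i)"
    if "c \<in> {..<p} \<rightarrow> carrier G" for c and p :: nat and u v :: "nat \<Rightarrow> nat"
  proof -
    have "(\<Otimes>i\<in>{..<p}. c i [^] (u i + v i)) = (\<Otimes>i\<in>{..<p}. c i [^] u i \<otimes> c i [^] v i)"
      using that by (intro finprod_cong') (auto simp: nat_pow_mult Pi_iff)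
    also have "\<dots> = (\<Otimes>i\<in>{..<p}. c i [^] u i) \<otimes> (\<Otimes>i\<in>{..<p}. c i [^] v i)"
      using that by (intro finprod_multf) (auto simp: Pi_iff)
    finally show ?thesis .
  qed
  have "(\<Otimes>j\<in>{..<l}. b j [^] m j) \<in> carrier G" "(\<Otimes>j\<in>{..<l}. b j [^] m' j) \<in> carrier G"
    using b by (auto intro!: finprod_closed)
  then have "d \<otimes> e \<otimes> (\<Otimes>j\<in>{..<l}. b j [^] (m j + m' j)) = (\<Otimes>i\<in>{..<k}. a i [^] (n i + n' i))"
    using c by (simp add: split[OF a] split[OF b] d(3)[symmetric] e(3)[symmetric] m_ac)
  then show ?case
    using d e by (intro exI[of _ "\<lambda>i. n i + n' i"] exI[of _ "\<lambda>j. m j + m' j"])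
      (simp add: sum.distrib)
qed

end

lemma (in group_hom) hom_finprod_pow:
  assumes "comm_group G" "comm_group H" "c \<in> {..<k::nat} \<rightarrow> carrier G"
  shows "h (\<Otimes>i\<in>{..<k}. c i [^] n i) = (\<Otimes>\<^bsub>H\<^esub>i\<in>{..<k}. h (c i) [^]\<^bsub>H\<^esub> (n i :: nat))"
proof -
  interpret cG: comm_group G by fact
  interpret cH: comm_group H by fact
  show ?thesis
    using assms(3)
  proof (induction k)
    case (Suc k)
    then have c: "c k \<in> carrier G" "c \<in> {..<k} \<rightarrow> carrier G" by auto
    then have "(\<Otimes>i\<in>{..<k}. c i [^] n i) \<in> carrier G" by (auto intro!: cG.finprod_closed)
    moreover have "(\<lambda>i. c i [^] n i) \<in> {..<k} \<rightarrow> carrier G"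
      "(\<lambda>i. h (c i) [^]\<^bsub>H\<^esub> n i) \<in> {..<k} \<rightarrow> carrier H"
      using c by (auto simp: Pi_iff)
    ultimately show ?case
      using c Suc.IH by (simp add: lessThan_Suc hom_nat_pow)
  qed simp
qed

section \<open>Comparing freely generated lattice-ordered groups\<close>

lemma l_group_hom_compose:
  assumes "g \<in> l_group_hom G H" "h \<in> l_group_hom H K" "l_group G"
  shows "compose (carrier G) h g \<in> l_group_hom G K"
proof -
  interpret l_group G by fact
  have c: "g x \<in> carrier H" if "x \<in> carrier G" for x
    using assms(1) that by (auto simp: l_group_hom_def hom_def)
  then show ?thesis
    using assms(1,2) by (auto simp: l_group_hom_def hom_def compose_def)
qed

text \<open>The usual uniqueness of universal objects, across two types. The four instances
  correspond to the four morphisms: from \<open>H\<close> to \<open>L\<close> and back, and the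
  endomorphisms of \<open>H\<close> and of \<open>L\<close> that must be identities.\<close>

lemma freely_generated_iso:
  fixes H :: "'h ogroup" and L :: "'l ogroup"
  assumes H: "freely_generated TYPE('h) G H \<phi>" "freely_generated TYPE('l) G H \<phi>"
    and L: "freely_generated TYPE('h) G L \<gamma>" "freely_generated TYPE('l) G L \<gamma>"
  shows "\<exists>\<psi>\<in>l_group_hom H L. bij_betw \<psi> (carrier H) (carrier L) \<and> (\<forall>x\<in>carrier G. \<psi> (\<phi> x) = \<gamma> x)"
proof -
  have lH: "l_group H" "\<phi> \<in> ogroup_hom G H" and lL: "l_group L" "\<gamma> \<in> ogroup_hom G L"
    using H(1) L(1) by (auto simp: freely_generated_def)
  have carr: "\<phi> x \<in> carrier H" "\<gamma> x \<in> carrier L" if "x \<in> carrier G" for x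
    using lH(2) lL(2) that by (auto simp: ogroup_hom_def hom_def)
  obtain \<psi> where \<psi>: "\<psi> \<in> l_group_hom H L" "\<forall>x\<in>carrier G. \<psi> (\<phi> x) = \<gamma> x"
    using H(2) lL unfolding freely_generated_def by metis
  obtain \<chi> where \<chi>: "\<chi> \<in> l_group_hom L H" "\<forall>x\<in>carrier G. \<chi> (\<gamma> x) = \<phi> x"
    using L(1) lH unfolding freely_generated_def by metis
  have id: "restrict (\<lambda>x. x) (carrier K) \<in> l_group_hom K K" if "l_group K" for K :: "'k ogroup"
  proof -
    interpret K: l_group K by fact
    show ?thesis by (auto simp: l_group_hom_def hom_def)
  qed
  have "compose (carrier H) \<chi> \<psi> = restrict (\<lambda>x. x) (carrier H)"
  proof -
    define U where "U g \<longleftrightarrow> g \<in> l_group_hom H H \<and> g \<in> extensional (carrier H) \<and>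
      (\<forall>x\<in>carrier G. g (\<phi> x) = \<phi> x)" for g
    have "\<exists>!g. U g"
      using H(1) lH unfolding freely_generated_def U_def by simp
    moreover have "U (compose (carrier H) \<chi> \<psi>)"
      using l_group_hom_compose[OF \<psi>(1) \<chi>(1) lH(1)] \<psi>(2) \<chi>(2) carr
      by (simp add: U_def compose_eq)
    moreover have "U (restrict (\<lambda>x. x) (carrier H))"
      using id[OF lH(1)] carr by (simp add: U_def)
    ultimately show ?thesis by blast
  qed
  then have 1: "\<chi> (\<psi> x) = x" if "x \<in> carrier H" for x
    using that by (metis compose_eq restrict_apply')
  have "compose (carrier L) \<psi> \<chi> = restrict (\<lambda>x. x) (carrier L)"
  proof -
    define U where "U g \<longleftrightarrow> g \<in> l_group_hom L L \<and> g \<in> extensional (carrier L) \<and>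
      (\<forall>x\<in>carrier G. g (\<gamma> x) = \<gamma> x)" for g
    have "\<exists>!g. U g"
      using L(2) lL unfolding freely_generated_def U_def by simp
    moreover have "U (compose (carrier L) \<psi> \<chi>)"
      using l_group_hom_compose[OF \<chi>(1) \<psi>(1) lL(1)] \<chi>(2) \<psi>(2) carr
      by (simp add: U_def compose_eq)
    moreover have "U (restrict (\<lambda>x. x) (carrier L))"
      using id[OF lL(1)] carr by (simp add: U_def)
    ultimately show ?thesis by blast
  qed
  then have 2: "\<psi> (\<chi> x) = x" if "x \<in> carrier L" for x
    using that by (metis compose_eq restrict_apply')
  have "bij_betw \<psi> (carrier H) (carrier L)"
    by (rule bij_betw_byWitness[of _ \<chi>]) (use 1 2 \<psi>(1) \<chi>(1) in \<open>auto simp: l_group_hom_def hom_def\<close>)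
  then show ?thesis using \<psi> by blast
qed

section \<open>Inequalities in the free lattice-ordered group\<close>

text \<open>From left to right a morphism from \<open>H\<close> to \<open>lorenzen_model G\<close>
  is enough, whence the instance of the universal property at the type of its elements. From right
  to left the argument stays in \<open>H\<close>: the inequality in \<open>G\<close> becomes one
  between equal powers of the meet and the join, and roots are taken.\<close>

lemma meet_le_join_iff:
  fixes G :: "'a ogroup" and H :: "'h ogroup"
  assumes G: "ordered_group G" and free: "freely_generated TYPE('a lterm set) G H \<phi>"
    and a: "a \<in> {..<k::nat} \<rightarrow> carrier G" and b: "b \<in> {..<l::nat} \<rightarrow> carrier G" and kl: "k \<ge> 1" "l \<ge> 1"
  shows "\<Sqinter>\<^bsub>poset_of H\<^esub>((\<lambda>i. \<phi> (a i)) ` {..<k}) \<preceq>\<^bsub>H\<^esub> \<Squnion>\<^bsub>poset_of H\<^esub>((\<lambda>j. \<phi> (b j)) ` {..<l}) \<longleftrightarrow>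
    (\<exists>(n :: nat \<Rightarrow> nat) (m :: nat \<Rightarrow> nat).
       (\<Sum>i<k. n i) = (\<Sum>j<l. m j) \<and> (\<Sum>j<l. m j) \<ge> 1 \<and>
       (\<Otimes>\<^bsub>G\<^esub>i\<in>{..<k}. a i [^]\<^bsub>G\<^esub> n i) \<preceq>\<^bsub>G\<^esub> (\<Otimes>\<^bsub>G\<^esub>j\<in>{..<l}. b j [^]\<^bsub>G\<^esub> m j))"
    (is "?I \<preceq>\<^bsub>H\<^esub> ?S \<longleftrightarrow> ?R")
proof -
  interpret G: ordered_group G by fact
  have H: "l_group H" and \<phi>: "\<phi> \<in> ogroup_hom G H" using free by (auto simp: freely_generated_def)
  interpret H: l_group H by fact
  interpret f: group_hom G H \<phi> by unfold_locales (rule ogroup_hom_hom[OF \<phi>])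
  have \<phi>X: "\<phi> \<in> carrier G \<rightarrow> carrier H" by auto
  have ac: "a i \<in> carrier G" if "i < k" for i using a that by auto
  have bc: "b j \<in> carrier G" if "j < l" for j using b that by auto
  have A: "finite ((\<lambda>i. \<phi> (a i)) ` {..<k})" "(\<lambda>i. \<phi> (a i)) ` {..<k} \<subseteq> carrier H"
    "(\<lambda>i. \<phi> (a i)) ` {..<k} \<noteq> {}"
    using ac kl by (auto simp: lessThan_empty_iff)
  have B: "finite ((\<lambda>j. \<phi> (b j)) ` {..<l})" "(\<lambda>j. \<phi> (b j)) ` {..<l} \<subseteq> carrier H"
    "(\<lambda>j. \<phi> (b j)) ` {..<l} \<noteq> {}"
    using bc kl by (auto simp: lessThan_empty_iff)
  note IS = H.finite_inf_closed[OF A] H.finite_sup_closed[OF B]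
  show ?thesis
  proof
    assume le: "?I \<preceq>\<^bsub>H\<^esub> ?S"
    let ?L = "lorenzen_model G" and ?\<gamma> = "lorenzen_gen G (rhd_s G)"
    have L: "lorenzen_group G (rhd_s G) ?L" by (rule G.lorenzen_group_lorenzen_model)
    obtain g where g: "g \<in> l_group_hom H ?L" "\<forall>x\<in>carrier G. g (\<phi> x) = ?\<gamma> x"
      using free G.lorenzen_l_group[OF L] G.lorenzen_gen_ogroup_hom[OF L]
      unfolding freely_generated_def by metis
    \<comment> \<open>\<open>Meets\<close> and \<open>Joins\<close> take the head of a list as a
      separate argument, so the tails start at index 1.\<close>
    define as where "as = map a [1..<k]"
    define bs where "bs = map b [1..<l]"
    have "set (c 0 # map c [1..<p]) = c ` {..<p}" if "p \<ge> 1" for c :: "nat \<Rightarrow> 'a" and p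
    proof -
      have "{..<p} = insert 0 {1..<p}" using that by auto
      then show ?thesis by simp
    qed
    then have sets: "set (a 0 # as) = a ` {..<k}" "set (b 0 # bs) = b ` {..<l}"
      using kl unfolding as_def bs_def by blast+
    then have AB: "set (a 0 # as) \<subseteq> carrier G" "set (b 0 # bs) \<subseteq> carrier G" using ac bc by auto
    then have terms: "Meets (a 0) as \<in> lterms (carrier G)" "Joins (b 0) bs \<in> lterms (carrier G)" by auto
    define M where "M = interp H \<phi> (Meets (a 0) as)"
    define J where "J = interp H \<phi> (Joins (b 0) bs)"
    have MJ: "M \<in> carrier H" "J \<in> carrier H"
      using H.interp_closed[OF \<phi>X] terms unfolding M_def J_def by auto
    \<comment> \<open>Infima of sets are compared with nested binary meets, and likewise for joins,
      just in the directions that compose to \<open>M \<preceq> J\<close>.\<close>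
    have "M \<preceq>\<^bsub>H\<^esub> ?I"
      using A MJ H.interp_Meets_le[OF \<phi>X AB(1)] unfolding sets
      by (intro H.finite_inf_greatest) (auto simp: M_def)
    moreover have "?S \<preceq>\<^bsub>H\<^esub> J"
      using B MJ H.le_interp_Joins[OF \<phi>X AB(2)] unfolding sets
      by (intro H.finite_sup_least) (auto simp: J_def)
    ultimately have "M \<preceq>\<^bsub>H\<^esub> J"
      using H.le_trans[OF H.le_trans[OF _ le]] MJ IS by blast
    then have "g M \<preceq>\<^bsub>?L\<^esub> g J"
      using l_group_hom_mono[OF g(1) H G.l_group_lorenzen_model MJ] by simp
    moreover have "g (interp H \<phi> s) = G.cls s" if "s \<in> lterms (carrier G)" for s
      using l_group_hom_interp[OF g(1) H \<phi>X _ that] g(2) G.interp_lorenzen_gen[OF L that] by simp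
    ultimately have "G.tle (Meets (a 0) as) (Joins (b 0) bs)"
      using terms G.lorenzen_ole[OF L] by (simp add: M_def J_def)
    \<comment> \<open>A derivable inequality need not come from the rule \<open>relation\<close>, so
      the way back to the regularisation leads through its validity in all total cones.\<close>
    then have "regularisation G (rhd_s G) (a ` {..<k}) (b ` {..<l})"
      using G.regularisation_of_teval[OF AB] G.teval_sound unfolding sets by blast
    then obtain d where d: "d \<in> semigroup_span G (a ` {..<k} <#>\<^bsub>G\<^esub> set_inv\<^bsub>G\<^esub> (b ` {..<l}))"
      "d \<preceq>\<^bsub>G\<^esub> \<one>\<^bsub>G\<^esub>"
      unfolding G.regularisation_rhd_s by blast
    obtain n m where nm: "(\<Sum>i<k. n i) = (\<Sum>j<l. m j :: nat)" "(\<Sum>j<l. m j) \<ge> 1"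
      "d \<otimes>\<^bsub>G\<^esub> (\<Otimes>\<^bsub>G\<^esub>j\<in>{..<l}. b j [^]\<^bsub>G\<^esub> m j) = (\<Otimes>\<^bsub>G\<^esub>i\<in>{..<k}. a i [^]\<^bsub>G\<^esub> n i)"
      using G.semigroup_span_diff[OF a b d(1)] by blast
    have "a ` {..<k} <#>\<^bsub>G\<^esub> set_inv\<^bsub>G\<^esub> (b ` {..<l}) \<subseteq> carrier G"
      using ac bc by (auto simp: set_mult_def SET_INV_def)
    then have dc: "d \<in> carrier G" using G.semigroup_span_closed d(1) by blast
    have "(\<Otimes>\<^bsub>G\<^esub>j\<in>{..<l}. b j [^]\<^bsub>G\<^esub> m j) \<in> carrier G" using b by (auto intro!: G.finprod_closed)
    then have "(\<Otimes>\<^bsub>G\<^esub>i\<in>{..<k}. a i [^]\<^bsub>G\<^esub> n i) \<preceq>\<^bsub>G\<^esub> (\<Otimes>\<^bsub>G\<^esub>j\<in>{..<l}. b j [^]\<^bsub>G\<^esub> m j)"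
      using G.mult_le_mult[OF d(2) G.le_refl] dc by (simp add: nm(3)[symmetric])
    then show ?R using nm by blast
  next
    assume ?R
    then obtain n m where nm: "(\<Sum>i<k. n i) = (\<Sum>j<l. m j :: nat)" "(\<Sum>j<l. m j) \<ge> 1"
      and le: "(\<Otimes>\<^bsub>G\<^esub>i\<in>{..<k}. a i [^]\<^bsub>G\<^esub> n i) \<preceq>\<^bsub>G\<^esub> (\<Otimes>\<^bsub>G\<^esub>j\<in>{..<l}. b j [^]\<^bsub>G\<^esub> m j)"
      by blast
    let ?x = "\<Otimes>\<^bsub>G\<^esub>i\<in>{..<k}. a i [^]\<^bsub>G\<^esub> n i" and ?y = "\<Otimes>\<^bsub>G\<^esub>j\<in>{..<l}. b j [^]\<^bsub>G\<^esub> m j"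
    have xy: "?x \<in> carrier G" "?y \<in> carrier G" using a b by (auto intro!: G.finprod_closed)
    note cg = G.comm_group_axioms H.comm_group_axioms
    have 1: "?I [^]\<^bsub>H\<^esub> (\<Sum>i<k. n i) \<preceq>\<^bsub>H\<^esub> \<phi> ?x"
      unfolding f.hom_finprod_pow[OF cg a]
      by (rule H.pow_sum_le_finprod) (use IS ac H.finite_inf_lower[OF A(1,2)] in auto)
    have 2: "\<phi> ?y \<preceq>\<^bsub>H\<^esub> ?S [^]\<^bsub>H\<^esub> (\<Sum>j<l. m j)"
      unfolding f.hom_finprod_pow[OF cg b]
      by (rule H.finprod_le_pow_sum) (use IS bc H.finite_sup_upper[OF B(1,2)] in auto)
    have "\<phi> ?x \<preceq>\<^bsub>H\<^esub> \<phi> ?y" using ogroup_hom_mono[OF \<phi> xy le] .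
    then have "?I [^]\<^bsub>H\<^esub> (\<Sum>j<l. m j) \<preceq>\<^bsub>H\<^esub> ?S [^]\<^bsub>H\<^esub> (\<Sum>j<l. m j)"
      using H.le_trans[OF H.le_trans[OF 1] 2] xy IS nm(1) by simp
    then show "?I \<preceq>\<^bsub>H\<^esub> ?S" using H.le_of_pow_le_pow[OF IS nm(2)] by simp
  qed
qed

text \<open>The case of one-element families, with \<open>\<one>\<close> on the left: its powers
  remain \<open>\<one>\<close>, and the common multiplicity is the exponent of
  \<open>a\<close>.\<close>

lemma one_le_iff:
  fixes G :: "'a ogroup" and H :: "'h ogroup"
  assumes G: "ordered_group G" and free: "freely_generated TYPE('a lterm set) G H \<phi>"
    and a: "a \<in> carrier G"
  shows "\<one>\<^bsub>H\<^esub> \<preceq>\<^bsub>H\<^esub> \<phi> a \<longleftrightarrow> (\<exists>n::nat. n \<ge> 1 \<and> \<one>\<^bsub>G\<^esub> \<preceq>\<^bsub>G\<^esub> a [^]\<^bsub>G\<^esub> n)"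
proof -
  interpret G: ordered_group G by fact
  have H: "l_group H" and \<phi>: "\<phi> \<in> ogroup_hom G H" using free by (auto simp: freely_generated_def)
  interpret H: l_group H by fact
  interpret f: group_hom G H \<phi> by unfold_locales (rule ogroup_hom_hom[OF \<phi>])
  have "\<Sqinter>\<^bsub>poset_of H\<^esub>{x} = x" "\<Squnion>\<^bsub>poset_of H\<^esub>{x} = x" if "x \<in> carrier H" for x
  proof -
    interpret L: lattice "poset_of H" by (rule H.lattice)
    show "\<Sqinter>\<^bsub>poset_of H\<^esub>{x} = x" "\<Squnion>\<^bsub>poset_of H\<^esub>{x} = x"
      using L.weak_inf_of_singleton[of x] L.weak_sup_of_singleton[of x] that by simp_all
  qed
  then have "\<one>\<^bsub>H\<^esub> \<preceq>\<^bsub>H\<^esub> \<phi> a \<longleftrightarrow>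
    \<Sqinter>\<^bsub>poset_of H\<^esub>((\<lambda>i. \<phi> \<one>\<^bsub>G\<^esub>) ` {..<1::nat}) \<preceq>\<^bsub>H\<^esub> \<Squnion>\<^bsub>poset_of H\<^esub>((\<lambda>j. \<phi> a) ` {..<1::nat})"
    using a by (simp add: lessThan_Suc)
  also have "\<dots> \<longleftrightarrow> (\<exists>(n :: nat \<Rightarrow> nat) (m :: nat \<Rightarrow> nat). n 0 = m 0 \<and> m 0 \<ge> 1 \<and> \<one>\<^bsub>G\<^esub> \<preceq>\<^bsub>G\<^esub> a [^]\<^bsub>G\<^esub> m 0)"
    using a by (subst meet_le_join_iff[OF G free]) (auto simp: lessThan_Suc)
  also have "\<dots> \<longleftrightarrow> (\<exists>n::nat. n \<ge> 1 \<and> \<one>\<^bsub>G\<^esub> \<preceq>\<^bsub>G\<^esub> a [^]\<^bsub>G\<^esub> n)"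
    by (auto intro: exI[of _ "\<lambda>_. _"])
  finally show ?thesis .
qed

theorem theorem4p15:
  fixes G :: "'a ogroup" and H :: "'h ogroup" and \<phi> :: "'a \<Rightarrow> 'h"
  assumes "ordered_group G"
    and "freely_generated TYPE('h) G H \<phi>"
    and "freely_generated TYPE('a lterm set) G H \<phi>"
  shows "
    (\<forall>a\<in>carrier G. \<one>\<^bsub>H\<^esub> \<preceq>\<^bsub>H\<^esub> \<phi> a \<longleftrightarrow> (\<exists>n::nat. n \<ge> 1 \<and> \<one>\<^bsub>G\<^esub> \<preceq>\<^bsub>G\<^esub> a [^]\<^bsub>G\<^esub> n)) \<and>
    (\<forall>(k::nat) (l::nat). \<forall>a \<in> {..<k} \<rightarrow> carrier G. \<forall>b \<in> {..<l} \<rightarrow> carrier G.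
           k \<ge> 1 \<longrightarrow> l \<ge> 1 \<longrightarrow>
           (\<Sqinter>\<^bsub>poset_of H\<^esub>((\<lambda>i. \<phi> (a i)) ` {..<k}) \<preceq>\<^bsub>H\<^esub> \<Squnion>\<^bsub>poset_of H\<^esub>((\<lambda>j. \<phi> (b j)) ` {..<l}) \<longleftrightarrow>
            (\<exists>(n :: nat \<Rightarrow> nat) (m :: nat \<Rightarrow> nat).
               (\<Sum>i<k. n i) = (\<Sum>j<l. m j) \<and> (\<Sum>j<l. m j) \<ge> 1 \<and>
               (\<Otimes>\<^bsub>G\<^esub>i\<in>{..<k}. a i [^]\<^bsub>G\<^esub> n i) \<preceq>\<^bsub>G\<^esub> (\<Otimes>\<^bsub>G\<^esub>j\<in>{..<l}. b j [^]\<^bsub>G\<^esub> m j)))) \<and>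
    (system_of_ideals G (rhd_s G) \<and> (\<forall>S. system_of_ideals G S \<longrightarrow> rhd_s G \<le> S)) \<and>
    (\<exists>L. lorenzen_group G (rhd_s G) L) \<and>
    (\<forall>L. lorenzen_group G (rhd_s G) L \<longrightarrow>
           freely_generated TYPE('u) G L (lorenzen_gen G (rhd_s G)) \<and>
           (\<exists>\<psi>\<in>l_group_hom H L. bij_betw \<psi> (carrier H) (carrier L) \<and>
              (\<forall>x\<in>carrier G. \<psi> (\<phi> x) = lorenzen_gen G (rhd_s G) x)))"
proof -
  interpret G: ordered_group G by fact
  show ?thesis
  proof (intro conjI ballI allI impI)
    show "\<one>\<^bsub>H\<^esub> \<preceq>\<^bsub>H\<^esub> \<phi> a \<longleftrightarrow> (\<exists>n::nat. n \<ge> 1 \<and> \<one>\<^bsub>G\<^esub> \<preceq>\<^bsub>G\<^esub> a [^]\<^bsub>G\<^esub> n)" if "a \<in> carrier G" for a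
      by (rule one_le_iff[OF assms(1,3) that])
    show "system_of_ideals G (rhd_s G)" by (rule G.system_rhd_s)
    show "rhd_s G \<le> S" if "system_of_ideals G S" for S by (rule G.rhd_s_least[OF that])
    show "\<exists>L. lorenzen_group G (rhd_s G) L" using G.lorenzen_group_lorenzen_model by blast
    fix L assume L: "lorenzen_group G (rhd_s G) L"
    show "freely_generated TYPE('u) G L (lorenzen_gen G (rhd_s G))"
      by (rule G.lorenzen_freely_generated[OF L])
    show "\<exists>\<psi>\<in>l_group_hom H L. bij_betw \<psi> (carrier H) (carrier L) \<and>
        (\<forall>x\<in>carrier G. \<psi> (\<phi> x) = lorenzen_gen G (rhd_s G) x)"
      \<comment> \<open>The instances for \<open>H\<close> are the two assumed ones, at the element
        types of \<open>H\<close> and of the Lorenzen group; the Lorenzen group has the property at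
        every type.\<close>
      by (rule freely_generated_iso[OF assms(2,3) G.lorenzen_freely_generated[OF L]
            G.lorenzen_freely_generated[OF L]])
  qed (rule meet_le_join_iff[OF assms(1,3)])
qed

end
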